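(* Let $\{|x\rangle\}_{x\in\mathcal X}$ be an orthonormal basis of $X$ and, for each $x$, let $\{\omega^{x,\theta}_B\}_\theta$ be a differentiable family of density operators. Define the classical--quantum channels $\mathcal N^\theta_{X\to B}(\sigma_X):=\sum_x\langle x|\sigma_X|x\rangle\,\omega^{x,\theta}_B$. Then $$I_F(\theta;\{\mathcal N^\theta_{X\to B}\}_\theta)=I^{\mathcal A}_F(\theta;\{\mathcal N^\theta_{X\to B}\}_\theta)=\sup_xI_F(\theta;\{\omega^{x,\theta}_B\}_\theta).$$
   Context: Finite-dimensional systems. For a differentiable family $\{\rho_\theta\}_\theta$ of density operators with spectral decomposition $\rho_\theta=\sum_j\lambda^j_\theta|\psi^j_\theta\rangle\langle\psi^j_\theta|$ and kernel projection $\Pi^\perp_{\rho_\theta}$, the SLD Fisher information is $I_F(\theta;\{\rho_\theta\}_\theta)=2\sum_{j,k:\lambda^j_\theta+\lambda^k_\theta>0}\frac{|\langle\psi^j_\theta|(\partial_\theta\rho_\theta)|\psi^k_\theta\rangle|^2}{\lambda^j_\theta+\lambda^k_\theta}$ if $\Pi^\perp_{\rho_\theta}(\partial_\theta\rho_\theta)\Pi^\perp_{\rho_\theta}=0$, else $+\infty$. For a channel family, $I_F(\theta;\{\mathcal N^\theta_{A\to B}\}_\theta):=\sup_{\rho_{RA}}I_F(\theta;\{\mathcal N^\theta_{A\to B}(\rho_{RA})\}_\theta)$ over states $\rho_{RA}$ with arbitrary reference $R$, and the amortized version is $I^{\mathcal A}_F(\theta;\{\mathcal N^\theta_{A\to B}\}_\theta):=\sup_{\{\rho^\theta_{RA}\}_\theta}[I_F(\theta;\{\mathcal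 N^\theta_{A\to B}(\rho^\theta_{RA})\}_\theta)-I_F(\theta;\{\rho^\theta_{RA}\}_\theta)]$ over differentiable families of states with arbitrary $R$. *)

theory Defs
  imports "Jordan_Normal_Form.Schur_Decomposition" "HOL-Analysis.Derivative"
          "HOL-Library.Extended_Real"
begin

text \<open>Finite-dimensional quantum states as complex square matrices (Jordan_Normal_Form).
  A system of dimension n has states in carrier_mat n n. A bipartite system R (x) A of
  dimensions r, dA uses the index convention (i, a) |-> i * dA + a.\<close>

definition trace_c :: "complex mat \<Rightarrow> complex" where
  "trace_c A = (\<Sum>i<dim_row A. A $$ (i,i))"

definition density_op :: "nat \<Rightarrow> complex mat \<Rightarrow> bool" where
  "density_op n \<rho> \<longleftrightarrow> \<rho> \<in> carrier_mat n n \<and> mat_adjoint \<rho> = \<rho> \<and>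
     (\<forall>v \<in> carrier_vec n. 0 \<le> Re ((\<rho> *\<^sub>v v) \<bullet>c v)) \<and> trace_c \<rho> = 1"

definition unitary_c :: "nat \<Rightarrow> complex mat \<Rightarrow> bool" where
  "unitary_c n U \<longleftrightarrow> U \<in> carrier_mat n n \<and> mat_adjoint U * U = 1\<^sub>m n"

definition spectral_decomp :: "nat \<Rightarrow> complex mat \<Rightarrow> complex mat \<Rightarrow> (nat \<Rightarrow> real) \<Rightarrow> bool" where
  "spectral_decomp n \<rho> U l \<longleftrightarrow> unitary_c n U \<and>
     \<rho> = U * mat_diag n (\<lambda>j. complex_of_real (l j)) * mat_adjoint U"

definition mat_family_diff :: "nat \<Rightarrow> (real \<Rightarrow> complex mat) \<Rightarrow> bool" where
  "mat_family_diff n F \<longleftrightarrow> (\<forall>t. \<forall>i<n. \<forall>j<n. (\<lambda>s. F s $$ (i,j)) differentiable (at t))"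

definition mat_deriv :: "nat \<Rightarrow> (real \<Rightarrow> complex mat) \<Rightarrow> real \<Rightarrow> complex mat" where
  "mat_deriv n F t = Matrix.mat n n (\<lambda>(i,j). vector_derivative (\<lambda>s. F s $$ (i,j)) (at t))"

definition SLD_fisher :: "nat \<Rightarrow> (real \<Rightarrow> complex mat) \<Rightarrow> real \<Rightarrow> ereal" where
  "SLD_fisher n F t =
    (let \<rho> = F t; D = mat_deriv n F t;
         p = (SOME p. spectral_decomp n \<rho> (fst p) (snd p));
         U = fst p; l = snd p;
         Pker = Matrix.mat n n (\<lambda>(a,b). \<Sum>j\<in>{j. j < n \<and> l j = 0}. U $$ (a,j) * cnj (U $$ (b,j)))
     in if Pker * D * Pker \<noteq> 0\<^sub>m n n then \<infinity>
        else ereal (2 * (\<Sum>(j,k)\<in>{(j,k). j < n \<and> k < n \<and> l j + l k > 0}.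
                 (cmod ((D *\<^sub>v col U k) \<bullet>c col U j))\<^sup>2 / (l j + l k))))"

text \<open>(id_R (x) N)(rho_RA) for a linear map N from dA x dA to dB x dB matrices,
  R of dimension r: acts blockwise.\<close>
definition id_tensor :: "nat \<Rightarrow> nat \<Rightarrow> nat \<Rightarrow> (complex mat \<Rightarrow> complex mat) \<Rightarrow> complex mat \<Rightarrow> complex mat" where
  "id_tensor r dA dB N \<rho> = Matrix.mat (r * dB) (r * dB)
     (\<lambda>(p,q). N (Matrix.mat dA dA (\<lambda>(a,b). \<rho> $$ ((p div dB) * dA + a, (q div dB) * dA + b)))
               $$ (p mod dB, q mod dB))"

definition channel_fisher :: "nat \<Rightarrow> nat \<Rightarrow> (real \<Rightarrow> complex mat \<Rightarrow> complex mat) \<Rightarrow> real \<Rightarrow> ereal" where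
  "channel_fisher dA dB N t =
     (SUP p \<in> {(r, \<rho>). 0 < r \<and> density_op (r * dA) \<rho>}.
        SLD_fisher (fst p * dB) (\<lambda>s. id_tensor (fst p) dA dB (N s) (snd p)) t)"

text \<open>Amortized Fisher information: sup over reference dimensions r >= 1 and
  differentiable families of states rho_RA^s (with finite input Fisher information,
  so that the difference is defined).\<close>
definition amortized_channel_fisher :: "nat \<Rightarrow> nat \<Rightarrow> (real \<Rightarrow> complex mat \<Rightarrow> complex mat) \<Rightarrow> real \<Rightarrow> ereal" where
  "amortized_channel_fisher dA dB N t =
     (SUP p \<in> {(r, F). 0 < r \<and> (\<forall>s. density_op (r * dA) (F s)) \<and> mat_family_diff (r * dA) F
                       \<and> SLD_fisher (r * dA) F t < \<infinity>}.
        SLD_fisher (fst p * dB) (\<lambda>s. id_tensor (fst p) dA dB (N s) (snd p s)) t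
        - SLD_fisher (fst p * dA) (snd p) t)"

definition cq_channel :: "nat \<Rightarrow> nat \<Rightarrow> (nat \<Rightarrow> real \<Rightarrow> complex mat) \<Rightarrow> real \<Rightarrow> complex mat \<Rightarrow> complex mat" where
  "cq_channel dX dB \<omega> t \<sigma> = Matrix.mat dB dB (\<lambda>(a,b). \<Sum>x<dX. \<sigma> $$ (x,x) * \<omega> x t $$ (a,b))"

end

theory Submission
  imports Defs "Jordan_Normal_Form.Spectral_Radius"
begin

text \<open>
  The SLD Fisher information has the variational form
  \<open>I\<^sub>F = sup {2 tr (D X) - tr (\<rho> X\<^sup>2) | X Hermitian}\<close>, where \<open>D\<close> is the derivative of \<open>\<rho>\<close>;
  a maximizer is a logarithmic derivative \<open>L\<close> with \<open>2 D = \<rho> L + L \<rho>\<close>.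
  The output of the classical--quantum channel is \<open>\<Sum>\<^sub>x P\<^sub>x \<otimes> \<omega>\<^sub>x\<close>, where \<open>P\<^sub>x\<close> are the diagonal blocks
  of the input. Given a test operator \<open>X\<close> for the output, let \<open>Y\<^sub>x\<close> be the partial trace of
  \<open>(1 \<otimes> \<omega>\<^sub>x) X\<close> and \<open>L\<^sub>x\<close> a logarithmic derivative of \<open>\<omega>\<^sub>x\<close>. Expanding
  \<open>0 \<le> tr ((P\<^sub>x \<otimes> \<omega>\<^sub>x) (X - Y\<^sub>x \<otimes> 1 - 1 \<otimes> L\<^sub>x)\<^sup>2)\<close> and summing over \<open>x\<close> bounds the value of \<open>X\<close> by the
  value of the test operator \<open>\<Sum>\<^sub>x Y\<^sub>x \<otimes> |x\<rangle>\<langle>x|\<close> for the input plus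
  \<open>\<Sum>\<^sub>x tr P\<^sub>x I\<^sub>F(\<omega>\<^sub>x) \<le> max\<^sub>x I\<^sub>F(\<omega>\<^sub>x)\<close>. So no input family gains more than \<open>max\<^sub>x I\<^sub>F(\<omega>\<^sub>x)\<close>,
  which the inputs \<open>|x\<rangle>\<langle>x|\<close> attain without a reference system.
\<close>

unbundle no vec_syntax

subsection \<open>Adjoints and the spectral theorem\<close>

lemma mat_adjoint_dim [simp]:
  "dim_row (mat_adjoint A) = dim_col A" "dim_col (mat_adjoint A) = dim_row A"
  by (simp_all add: mat_adjoint_def)

lemma mat_adjoint_carrier [simp]:
  "A \<in> carrier_mat n m \<Longrightarrow> mat_adjoint A \<in> carrier_mat m n"
  by (rule carrier_matI) simp_all

lemma mat_adjoint_index [simp]: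
  fixes A :: "complex mat"
  assumes "i < dim_col A" "j < dim_row A"
  shows "mat_adjoint A $$ (i,j) = cnj (A $$ (j,i))"
  using assms by (simp add: mat_adjoint_def mat_of_rows_def)

lemma mat_adjoint_adjoint [simp]: "mat_adjoint (mat_adjoint A) = (A :: complex mat)"
  by (rule eq_matI) auto

lemma mult_mat_index:
  assumes "A \<in> carrier_mat n m" "B \<in> carrier_mat m k" "i < n" "j < k"
  shows "(A * B) $$ (i,j) = (\<Sum>l<m. A $$ (i,l) * B $$ (l,j))"
  using assms by (simp add: scalar_prod_def atLeast0LessThan)

lemma mult_carrier_mat_square [simp]:
  "A \<in> carrier_mat n n \<Longrightarrow> B \<in> carrier_mat n n \<Longrightarrow> A * B \<in> carrier_mat n n"
  by (rule mult_carrier_mat)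

lemma mat_adjoint_mult:
  fixes A B :: "complex mat"
  assumes "A \<in> carrier_mat n m" "B \<in> carrier_mat m k"
  shows "mat_adjoint (A * B) = mat_adjoint B * mat_adjoint A"
proof (rule eq_matI)
  fix i j assume "i < dim_row (mat_adjoint B * mat_adjoint A)"
    "j < dim_col (mat_adjoint B * mat_adjoint A)"
  hence ij: "i < k" "j < n" using assms by auto
  have "mat_adjoint (A * B) $$ (i,j) = cnj (\<Sum>l<m. A $$ (j,l) * B $$ (l,i))"
    using assms ij by (simp add: mult_mat_index del: index_mult_mat(1))
  also have "\<dots> = (\<Sum>l<m. mat_adjoint B $$ (i,l) * mat_adjoint A $$ (l,j))"
    using assms ij by (auto simp: mult.commute)
  also have "\<dots> = (mat_adjoint B * mat_adjoint A) $$ (i,j)"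
    using assms ij by (simp add: mult_mat_index[of _ k m _ n] del: index_mult_mat(1))
  finally show "mat_adjoint (A * B) $$ (i,j) = (mat_adjoint B * mat_adjoint A) $$ (i,j)" .
qed (use assms in auto)

lemma mat_adjoint_add:
  fixes A B :: "complex mat"
  assumes "A \<in> carrier_mat n m" "B \<in> carrier_mat n m"
  shows "mat_adjoint (A + B) = mat_adjoint A + mat_adjoint B"
  by (rule eq_matI) (use assms in auto)

lemma mat_adjoint_minus:
  fixes A B :: "complex mat"
  assumes "A \<in> carrier_mat n m" "B \<in> carrier_mat n m"
  shows "mat_adjoint (A - B) = mat_adjoint A - mat_adjoint B"
  by (rule eq_matI) (use assms in auto)

lemma hermitian_index:
  fixes A :: "complex mat"
  assumes "A \<in> carrier_mat n n" "mat_adjoint A = A" "i < n" "j < n"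
  shows "A $$ (i,j) = cnj (A $$ (j,i))"
  using mat_adjoint_index[of i A j] assms by simp

lemma hermitianI:
  fixes A :: "complex mat"
  assumes "A \<in> carrier_mat n n" "\<And>i j. i < n \<Longrightarrow> j < n \<Longrightarrow> A $$ (i,j) = cnj (A $$ (j,i))"
  shows "mat_adjoint A = A"
proof (rule eq_matI)
  fix i j assume "i < dim_row A" "j < dim_col A"
  then show "mat_adjoint A $$ (i,j) = A $$ (i,j)"
    using assms(1) assms(2)[of i j, symmetric] by simp
qed (use assms(1) in auto)

section \<open>Unitary matrices and diagonalization\<close>

lemma unitary_c_carrier: "unitary_c n U \<Longrightarrow> U \<in> carrier_mat n n"
  by (simp add: unitary_c_def)

lemma unitary_c_right:
  assumes "unitary_c n U"
  shows "U * mat_adjoint U = 1\<^sub>m n"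
  using assms mat_mult_left_right_inverse[of "mat_adjoint U" n U] by (auto simp: unitary_c_def)

lemma unitary_cI:
  assumes "U \<in> carrier_mat n n"
    "\<And>i j. i < n \<Longrightarrow> j < n \<Longrightarrow> (\<Sum>k<n. cnj (U $$ (k,i)) * U $$ (k,j)) = (if i = j then 1 else 0)"
  shows "unitary_c n U"
  unfolding unitary_c_def
proof
  show "mat_adjoint U * U = 1\<^sub>m n"
  proof (rule eq_matI)
    fix i j assume "i < dim_row (1\<^sub>m n)" "j < dim_col (1\<^sub>m n)"
    hence ij: "i < n" "j < n" by auto
    have "(mat_adjoint U * U) $$ (i,j) = (\<Sum>k<n. mat_adjoint U $$ (i,k) * U $$ (k,j))"
      by (rule mult_mat_index) (use assms ij in auto)
    also have "\<dots> = (\<Sum>k<n. cnj (U $$ (k,i)) * U $$ (k,j))"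
      using assms(1) ij by (intro sum.cong) auto
    finally show "(mat_adjoint U * U) $$ (i,j) = 1\<^sub>m n $$ (i,j)" using assms(2) ij by simp
  qed (use assms in auto)
qed fact

lemma unitary_c_index:
  assumes "unitary_c n U" "i < n" "j < n"
  shows "(\<Sum>k<n. cnj (U $$ (k,i)) * U $$ (k,j)) = (if i = j then 1 else 0)"
proof -
  have "(\<Sum>k<n. cnj (U $$ (k,i)) * U $$ (k,j)) = (\<Sum>k<n. mat_adjoint U $$ (i,k) * U $$ (k,j))"
    using assms unitary_c_carrier[OF assms(1)] by (intro sum.cong) auto
  also have "\<dots> = (mat_adjoint U * U) $$ (i,j)"
    by (rule mult_mat_index[symmetric]) (use assms unitary_c_carrier[OF assms(1)] in auto)
  also have "\<dots> = (if i = j then 1 else 0)" using assms by (simp add: unitary_c_def)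
  finally show ?thesis .
qed

lemma unitary_c_mult:
  assumes "unitary_c n U" "unitary_c n V"
  shows "unitary_c n (U * V)"
proof -
  have U: "U \<in> carrier_mat n n" and V: "V \<in> carrier_mat n n"
    using assms unitary_c_carrier by auto
  have "mat_adjoint (U * V) * (U * V) = mat_adjoint V * (mat_adjoint U * U) * V"
    using U V by (simp add: mat_adjoint_mult[OF U V] assoc_mult_mat[of _ n n _ n _ n])
  also have "\<dots> = 1\<^sub>m n" using assms V by (simp add: unitary_c_def)
  finally show ?thesis using U V by (simp add: unitary_c_def)
qed

text \<open>Gram-Schmidt applied to a basis completion that begins with \<open>v\<close> keeps
  \<open>v\<close> as its first vector. Normalizing the vectors gives a unitary, so the first column
  is \<open>v\<close> only up to a scalar.\<close>

lemma exists_unitary_first_col: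
  fixes v :: "complex Matrix.vec"
  assumes v: "v \<in> carrier_vec n" and v0: "v \<noteq> 0\<^sub>v n" and n: "0 < n"
  shows "\<exists>W c. unitary_c n W \<and> col W 0 = c \<cdot>\<^sub>v v"
proof -
  interpret cof_vec_space n "TYPE(complex)" .
  define ws where "ws = gram_schmidt n (basis_completion v)"
  note bc = basis_completion[OF v v0]
  note gs = gram_schmidt_result[OF bc(2) bc(4) bc(5) ws_def]
  have "basis_completion v = v # tl (basis_completion v)"
    using bc(6,7) n by (cases "basis_completion v") auto
  then have hd: "hd ws = v" unfolding ws_def by (metis gram_schmidt_hd v)
  have len: "length ws = n" using gs bc by simp
  have ws0: "ws ! 0 = v" using hd n len by (metis hd_conv_nth length_0_conv less_not_refl)
  have wsc: "ws ! i \<in> carrier_vec n" if "i < n" for i using gs(3) len that by auto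
  \<comment> \<open>Euclidean norms of the Gram-Schmidt vectors, which are orthogonal and nonzero
    but not yet normalized.\<close>
  define c where "c i = sqrt (\<Sum>a<n. (cmod (ws ! i $ a))\<^sup>2)" for i
  have sp: "ws ! i \<bullet>c ws ! j = (\<Sum>a<n. ws ! i $ a * cnj (ws ! j $ a))" if "i < n" "j < n" for i j
    using wsc[OF that(1)] wsc[OF that(2)] by (simp add: scalar_prod_def atLeast0LessThan)
  have csq: "complex_of_real (c i * c i) = ws ! i \<bullet>c ws ! i" if "i < n" for i
    using that by (simp add: sp c_def sum_nonneg complex_norm_square del: of_real_power)
  have c0: "c i \<noteq> 0" if "i < n" for i
    using csq[OF that] corthogonalD[OF gs(2), of i i] len that by auto
  define W where "W = Matrix.mat n n (\<lambda>(a,j). ws ! j $ a / complex_of_real (c j))"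
  have "unitary_c n W"
  proof (rule unitary_cI)
    fix i j assume ij: "i < n" "j < n"
    have "(\<Sum>k<n. cnj (W $$ (k,i)) * W $$ (k,j)) =
        (\<Sum>k<n. ws ! j $ k * cnj (ws ! i $ k)) / (complex_of_real (c i) * complex_of_real (c j))"
      unfolding sum_divide_distrib using ij by (intro sum.cong) (auto simp: W_def)
    also have "\<dots> = (ws ! j \<bullet>c ws ! i) / (complex_of_real (c i) * complex_of_real (c j))"
      using ij by (simp add: sp)
    also have "\<dots> = (if i = j then 1 else 0)"
      using csq[of i] c0[of i] ij corthogonalD[OF gs(2), of j i] len by auto
    finally show "(\<Sum>k<n. cnj (W $$ (k,i)) * W $$ (k,j)) = (if i = j then 1 else 0)" .
  qed (simp add: W_def)
  moreover have "col W 0 = (1 / complex_of_real (c 0)) \<cdot>\<^sub>v v"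
    by (rule eq_vecI) (use n v ws0 in \<open>auto simp: W_def\<close>)
  ultimately show ?thesis by blast
qed

lemma conj_mat_diag_index:
  assumes U: "U \<in> carrier_mat n n" and ij: "i < n" "j < n"
  shows "(U * mat_diag n d * mat_adjoint U) $$ (i,j) = (\<Sum>k<n. U $$ (i,k) * d k * cnj (U $$ (j,k)))"
proof -
  have "(U * mat_diag n d * mat_adjoint U) $$ (i,j)
      = (\<Sum>k<n. (U * mat_diag n d) $$ (i,k) * mat_adjoint U $$ (k,j))"
    by (rule mult_mat_index[OF mult_carrier_mat[OF U mat_diag_dim] mat_adjoint_carrier[OF U] ij])
  also have "\<dots> = (\<Sum>k<n. U $$ (i,k) * d k * cnj (U $$ (j,k)))"
    using U ij by (intro sum.cong) (auto simp: mat_diag_mult_right[OF U])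
  finally show ?thesis .
qed

text \<open>Deflation by induction on the dimension: an eigenvector is completed to a unitary
  \<open>W\<close>, in whose basis \<open>A\<close> splits into the eigenvalue and a Hermitian block
  of size \<open>n\<close>.\<close>

theorem hermitian_spectral_decomp:
  fixes A :: "complex mat"
  assumes "A \<in> carrier_mat n n" "mat_adjoint A = A"
  shows "\<exists>U l. spectral_decomp n A U l"
  using assms
proof (induction n arbitrary: A)
  case 0
  then have "spectral_decomp 0 A (1\<^sub>m 0) (\<lambda>_. 0)"
    unfolding spectral_decomp_def unitary_c_def by (intro conjI eq_matI) auto
  then show ?case by blast
next
  case (Suc n)
  let ?N = "Suc n"
  note A = Suc.prems(1)
  obtain e v where ev: "eigenvector A v e"
    using spectrum_non_empty[OF A zero_less_Suc] by (auto simp: spectrum_def eigenvalue_def)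
  have v: "v \<in> carrier_vec ?N" "v \<noteq> 0\<^sub>v ?N" and Av: "A *\<^sub>v v = e \<cdot>\<^sub>v v"
    using ev A by (auto simp: eigenvector_def)
  obtain W c where W: "unitary_c ?N W" and W0: "col W 0 = c \<cdot>\<^sub>v v"
    using exists_unitary_first_col[OF v] by auto
  have Wc: "W \<in> carrier_mat ?N ?N" using W by (rule unitary_c_carrier)
  define B where "B = mat_adjoint W * A * W"
  have B: "B \<in> carrier_mat ?N ?N" using A Wc by (auto simp: B_def)
  have Bh: "mat_adjoint B = B"
    unfolding B_def using A Wc Suc.prems(2)
    by (simp add: mat_adjoint_mult[of _ ?N ?N _ ?N] assoc_mult_mat[of _ ?N ?N _ ?N _ ?N])
  have AW0: "(A * W) $$ (k,0) = e * W $$ (k,0)" if "k < ?N" for k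
  proof -
    have "(A * W) $$ (k,0) = (A *\<^sub>v col W 0) $ k" using that A Wc by simp
    also have "A *\<^sub>v col W 0 = e \<cdot>\<^sub>v col W 0"
      unfolding W0 using v A Av
      by (simp add: mult_mat_vec[OF A] smult_smult_assoc mult.commute)
    finally show ?thesis using that Wc by simp
  qed
  \<comment> \<open>The first column of \<open>A * W\<close> is \<open>e\<close> times that of
    \<open>W\<close>, so unitarity of \<open>W\<close> leaves \<open>e\<close> times the first unit
    vector. The first row follows by Hermiticity.\<close>
  have B0: "B $$ (i,0) = (if i = 0 then e else 0)" if "i < ?N" for i
  proof -
    have "B $$ (i,0) = (mat_adjoint W * (A * W)) $$ (i,0)"
      unfolding B_def using A Wc by (simp add: assoc_mult_mat[of _ ?N ?N _ ?N _ ?N])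
    also have "\<dots> = (\<Sum>k<?N. mat_adjoint W $$ (i,k) * (A * W) $$ (k,0))"
      by (rule mult_mat_index) (use A Wc that in auto)
    also have "\<dots> = (\<Sum>k<?N. e * (cnj (W $$ (k,i)) * W $$ (k,0)))"
      using that Wc by (intro sum.cong) (auto simp: AW0 simp del: index_mult_mat(1))
    also have "\<dots> = e * (if i = 0 then 1 else 0)"
      unfolding sum_distrib_left[symmetric] using unitary_c_index[OF W that, of 0] by simp
    finally show ?thesis by simp
  qed
  have B0': "B $$ (0,i) = (if i = 0 then e else 0)" if "i < ?N" for i
    using hermitian_index[OF B Bh, of 0 i] B0[OF that] B0[of 0] that
    by (cases "i = 0") simp_all
  \<comment> \<open>\<open>e\<close> is a diagonal entry of the Hermitian matrix \<open>B\<close>,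
    hence real, as \<open>spectral_decomp\<close> requires.\<close>
  have e: "complex_of_real (Re e) = e"
    using hermitian_index[OF B Bh, of 0 0, symmetric] B0[of 0]
    by (metis Reals_cnj_iff of_real_Re zero_less_Suc)
  define C where "C = Matrix.mat n n (\<lambda>(i,j). B $$ (Suc i, Suc j))"
  have C: "C \<in> carrier_mat n n" by (simp add: C_def)
  have "mat_adjoint C = C"
  proof (rule hermitianI[OF C])
    fix i j assume "i < n" "j < n"
    then show "C $$ (i,j) = cnj (C $$ (j,i))"
      using hermitian_index[OF B Bh, of "Suc i" "Suc j"] by (simp add: C_def)
  qed
  from Suc.IH[OF C this] obtain V l where V: "unitary_c n V"
    and CV: "C = V * mat_diag n (\<lambda>j. complex_of_real (l j)) * mat_adjoint V"
    by (auto simp: spectral_decomp_def)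
  have Vc: "V \<in> carrier_mat n n" using V by (rule unitary_c_carrier)
  \<comment> \<open>Direct sum of the scalar 1 and \<open>V\<close>: it diagonalizes the lower block
    and leaves the eigenvector fixed.\<close>
  define V1 where "V1 = Matrix.mat ?N ?N (\<lambda>(i,j).
    if i = 0 \<and> j = 0 then 1 else if i = 0 \<or> j = 0 then 0 else V $$ (i - 1, j - 1))"
  have V1c: "V1 \<in> carrier_mat ?N ?N" by (simp add: V1_def)
  have V1: "unitary_c ?N V1"
  proof (rule unitary_cI[OF V1c])
    fix i j assume "i < ?N" "j < ?N"
    then show "(\<Sum>k<?N. cnj (V1 $$ (k,i)) * V1 $$ (k,j)) = (if i = j then 1 else 0)"
      using unitary_c_index[OF V, of "i - 1" "j - 1"]
      by (cases i; cases j) (auto simp: sum.lessThan_Suc_shift V1_def simp del: sum.lessThan_Suc)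
  qed
  define l1 where "l1 j = (case j of 0 \<Rightarrow> Re e | Suc k \<Rightarrow> l k)" for j
  have BV: "B = V1 * mat_diag ?N (\<lambda>j. complex_of_real (l1 j)) * mat_adjoint V1"
  proof (rule eq_matI)
    fix i j assume "i < dim_row (V1 * mat_diag ?N (\<lambda>j. complex_of_real (l1 j)) * mat_adjoint V1)"
      "j < dim_col (V1 * mat_diag ?N (\<lambda>j. complex_of_real (l1 j)) * mat_adjoint V1)"
    hence ij: "i < ?N" "j < ?N" using V1c by auto
    have CVi: "B $$ (Suc i, Suc j) = (\<Sum>k<n. V $$ (i,k) * complex_of_real (l k) * cnj (V $$ (j,k)))"
      if "i < n" "j < n" for i j
      using that arg_cong[OF CV, of "\<lambda>M. M $$ (i,j)"]
      by (simp add: conj_mat_diag_index[OF Vc] C_def del: index_mult_mat(1))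
    show "B $$ (i,j) = (V1 * mat_diag ?N (\<lambda>j. complex_of_real (l1 j)) * mat_adjoint V1) $$ (i,j)"
      unfolding conj_mat_diag_index[OF V1c ij]
      using ij e
      by (cases i; cases j)
        (auto simp: sum.lessThan_Suc_shift V1_def l1_def B0 B0' CVi simp del: sum.lessThan_Suc)
  qed (use B V1c in auto)
  have dc: "mat_diag ?N (\<lambda>j. complex_of_real (l1 j)) \<in> carrier_mat ?N ?N" by simp
  have "A = (W * mat_adjoint W) * A * (W * mat_adjoint W)"
    using unitary_c_right[OF W] A by simp
  also have "\<dots> = W * B * mat_adjoint W"
    unfolding B_def using A Wc
    by (simp add: assoc_mult_mat[of _ ?N ?N _ ?N _ ?N])
  also have "\<dots> = (W * V1) * mat_diag ?N (\<lambda>j. complex_of_real (l1 j)) * mat_adjoint (W * V1)"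
    unfolding BV mat_adjoint_mult[OF Wc V1c] using Wc V1c dc
    by (simp add: assoc_mult_mat[of _ ?N ?N _ ?N _ ?N])
  finally have "spectral_decomp ?N A (W * V1) l1"
    using unitary_c_mult[OF W V1] by (simp add: spectral_decomp_def)
  then show ?case by blast
qed

subsection \<open>Traces and positive semidefinite matrices\<close>

lemma trace_c_mult:
  assumes "A \<in> carrier_mat n m" "B \<in> carrier_mat m n"
  shows "trace_c (A * B) = (\<Sum>i<n. \<Sum>j<m. A $$ (i,j) * B $$ (j,i))"
  using assms by (auto simp: trace_c_def mult_mat_index[OF assms] simp del: index_mult_mat(1) intro!: sum.cong)

lemma trace_c_comm:
  assumes "A \<in> carrier_mat n m" "B \<in> carrier_mat m n"
  shows "trace_c (A * B) = trace_c (B * A)"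
  unfolding trace_c_mult[OF assms] trace_c_mult[OF assms(2,1)]
  by (subst sum.swap) (simp add: mult.commute)

lemma trace_c_add:
  assumes "A \<in> carrier_mat n n" "B \<in> carrier_mat n n"
  shows "trace_c (A + B) = trace_c A + trace_c B"
  using assms by (simp add: trace_c_def sum.distrib)

lemma trace_c_minus:
  assumes "A \<in> carrier_mat n n" "B \<in> carrier_mat n n"
  shows "trace_c (A - B) = trace_c A - trace_c B"
  using assms by (simp add: trace_c_def sum_subtractf)

lemma trace_c_adjoint_mult_self:
  assumes "B \<in> carrier_mat n m"
  shows "trace_c (mat_adjoint B * B) = complex_of_real (\<Sum>i<m. \<Sum>j<n. (cmod (B $$ (j,i)))\<^sup>2)"
  unfolding trace_c_mult[OF mat_adjoint_carrier[OF assms] assms] of_real_sum complex_norm_square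
  using assms by (intro sum.cong) (auto simp: mult.commute)

lemma quadratic_form_index:
  assumes "W \<in> carrier_mat n n" "v \<in> carrier_vec n"
  shows "(W *\<^sub>v v) \<bullet>c v = (\<Sum>i<n. \<Sum>j<n. W $$ (i,j) * v $ j * cnj (v $ i))"
  using assms by (simp add: scalar_prod_def atLeast0LessThan sum_distrib_right)

text \<open>Positivity separated from the trace condition of \<open>density_op\<close>, since the
  diagonal blocks of a state are positive but not normalized.\<close>

definition psd_mat :: "nat \<Rightarrow> complex mat \<Rightarrow> bool" where
  "psd_mat n W \<longleftrightarrow> W \<in> carrier_mat n n \<and> mat_adjoint W = W \<and>
     (\<forall>v \<in> carrier_vec n. 0 \<le> Re ((W *\<^sub>v v) \<bullet>c v))"

lemma density_op_iff: "density_op n \<rho> \<longleftrightarrow> psd_mat n \<rho> \<and> trace_c \<rho> = 1"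
  by (auto simp: density_op_def psd_mat_def)

lemma psd_mat_carrier: "psd_mat n W \<Longrightarrow> W \<in> carrier_mat n n"
  and psd_mat_hermitian: "psd_mat n W \<Longrightarrow> mat_adjoint W = W"
  by (simp_all add: psd_mat_def)

text \<open>The quadratic form at \<open>v\<close> is the squared norm of the adjoint of
  \<open>A\<close> applied to \<open>v\<close>; the rearranged sums display it as a sum of squared
  moduli.\<close>

lemma psd_mat_mult_adjoint:
  assumes A: "A \<in> carrier_mat n n"
  shows "psd_mat n (A * mat_adjoint A)"
  unfolding psd_mat_def
proof (intro conjI ballI)
  fix v :: "complex Matrix.vec" assume v: "v \<in> carrier_vec n"
  have AA: "(A * mat_adjoint A) $$ (i,j) = (\<Sum>k<n. A $$ (i,k) * cnj (A $$ (j,k)))"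
    if "i < n" "j < n" for i j
    unfolding mult_mat_index[OF A mat_adjoint_carrier[OF A] that]
    using A that by (intro sum.cong) auto
  have "((A * mat_adjoint A) *\<^sub>v v) \<bullet>c v
      = (\<Sum>i<n. \<Sum>j<n. (A * mat_adjoint A) $$ (i,j) * v $ j * cnj (v $ i))"
    using A v by (intro quadratic_form_index) auto
  also have "\<dots> = (\<Sum>i<n. \<Sum>j<n. \<Sum>k<n. (A $$ (i,k) * cnj (v $ i)) * cnj (A $$ (j,k) * cnj (v $ j)))"
    by (intro sum.cong refl)
      (simp add: AA sum_distrib_left mult_ac del: index_mult_mat(1))
  also have "\<dots> = (\<Sum>i<n. \<Sum>k<n. \<Sum>j<n. (A $$ (i,k) * cnj (v $ i)) * cnj (A $$ (j,k) * cnj (v $ j)))"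
    by (intro sum.cong refl sum.swap)
  also have "\<dots> = (\<Sum>k<n. \<Sum>i<n. \<Sum>j<n. (A $$ (i,k) * cnj (v $ i)) * cnj (A $$ (j,k) * cnj (v $ j)))"
    by (rule sum.swap)
  also have "\<dots> = (\<Sum>k<n. (\<Sum>i<n. A $$ (i,k) * cnj (v $ i)) * cnj (\<Sum>j<n. A $$ (j,k) * cnj (v $ j)))"
    by (simp only: cnj_sum sum_product)
  also have "\<dots> = complex_of_real (\<Sum>k<n. (cmod (\<Sum>i<n. A $$ (i,k) * cnj (v $ i)))\<^sup>2)"
    by (simp only: of_real_sum complex_norm_square)
  finally show "0 \<le> Re (((A * mat_adjoint A) *\<^sub>v v) \<bullet>c v)"
    by (simp add: sum_nonneg)
qed (use A in \<open>simp_all add: mat_adjoint_mult[of A n n _ n]\<close>)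

text \<open>Identifies the inner products in \<open>SLD_fisher\<close> with the entries of the
  derivative in the eigenbasis.\<close>

lemma adjoint_conj_index:
  fixes U D :: "complex mat"
  assumes U: "U \<in> carrier_mat n n" and D: "D \<in> carrier_mat n n" and jk: "j < n" "k < n"
  shows "(mat_adjoint U * D * U) $$ (j,k) = (D *\<^sub>v col U k) \<bullet>c col U j"
proof -
  have "(mat_adjoint U * D * U) $$ (j,k) = (mat_adjoint U * (D * U)) $$ (j,k)"
    using U D by (simp add: assoc_mult_mat[of _ n n _ n _ n])
  also have "\<dots> = (\<Sum>i<n. mat_adjoint U $$ (j,i) * (D * U) $$ (i,k))"
    using U D jk by (intro mult_mat_index) auto
  also have "\<dots> = (\<Sum>i<n. (D *\<^sub>v col U k) $ i * cnj (U $$ (i,j)))"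
    using U D jk by (intro sum.cong) auto
  also have "\<dots> = (D *\<^sub>v col U k) \<bullet>c col U j"
    using U D jk unfolding scalar_prod_def by (auto simp: atLeast0LessThan intro!: sum.cong)
  finally show ?thesis .
qed

section \<open>Conjugation by a fixed unitary, and square roots of positive matrices\<close>

context
  fixes n :: nat and U :: "complex mat"
  assumes U: "unitary_c n U"
begin

lemma unitary_conj_mult:
  assumes "A \<in> carrier_mat n n" "B \<in> carrier_mat n n"
  shows "(U * A * mat_adjoint U) * (U * B * mat_adjoint U) = U * (A * B) * mat_adjoint U"
proof -
  have c: "U \<in> carrier_mat n n" "mat_adjoint U \<in> carrier_mat n n"
    using unitary_c_carrier[OF U] by auto
  have "(U * A * mat_adjoint U) * (U * B * mat_adjoint U)
      = U * A * (mat_adjoint U * U) * (B * mat_adjoint U)"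
    using assms c by (simp add: assoc_mult_mat[of _ n n _ n _ n])
  also have "mat_adjoint U * U = 1\<^sub>m n" using U by (simp add: unitary_c_def)
  also have "U * A * 1\<^sub>m n * (B * mat_adjoint U) = U * (A * B) * mat_adjoint U"
    using assms c by (simp add: assoc_mult_mat[of _ n n _ n _ n])
  finally show ?thesis .
qed

lemma unitary_conj_add:
  assumes "A \<in> carrier_mat n n" "B \<in> carrier_mat n n"
  shows "U * A * mat_adjoint U + U * B * mat_adjoint U = U * (A + B) * mat_adjoint U"
  using assms unitary_c_carrier[OF U]
  by (simp add: mult_add_distrib_mat[of _ n n _ n] add_mult_distrib_mat[of _ n n _ _ n])

lemma trace_c_unitary_conj:
  assumes "A \<in> carrier_mat n n"
  shows "trace_c (U * A * mat_adjoint U) = trace_c A"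
proof -
  have c: "U \<in> carrier_mat n n" "mat_adjoint U \<in> carrier_mat n n"
    using unitary_c_carrier[OF U] by auto
  have "trace_c (U * A * mat_adjoint U) = trace_c (mat_adjoint U * (U * A))"
    using assms c by (intro trace_c_comm) auto
  also have "mat_adjoint U * (U * A) = mat_adjoint U * U * A"
    using assms c by (simp add: assoc_mult_mat[of _ n n _ n _ n])
  also have "\<dots> = A" using U assms by (simp add: unitary_c_def)
  finally show ?thesis .
qed

lemma unitary_conj_adjoint_conj:
  assumes "A \<in> carrier_mat n n"
  shows "U * (mat_adjoint U * A * U) * mat_adjoint U = A"
proof -
  have c: "U \<in> carrier_mat n n" "mat_adjoint U \<in> carrier_mat n n"
    using unitary_c_carrier[OF U] by auto
  have "U * (mat_adjoint U * A * U) * mat_adjoint U = (U * mat_adjoint U) * A * (U * mat_adjoint U)"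
    using assms c by (simp add: assoc_mult_mat[of _ n n _ n _ n])
  then show ?thesis using unitary_c_right[OF U] assms by simp
qed

lemma adjoint_conj_unitary_conj:
  assumes "A \<in> carrier_mat n n"
  shows "mat_adjoint U * (U * A * mat_adjoint U) * U = A"
proof -
  have c: "U \<in> carrier_mat n n" "mat_adjoint U \<in> carrier_mat n n"
    using unitary_c_carrier[OF U] by auto
  have "mat_adjoint U * (U * A * mat_adjoint U) * U = (mat_adjoint U * U) * A * (mat_adjoint U * U)"
    using assms c by (simp add: assoc_mult_mat[of _ n n _ n _ n])
  then show ?thesis using U assms by (simp add: unitary_c_def)
qed

lemma mat_adjoint_unitary_conj:
  assumes "A \<in> carrier_mat n n"
  shows "mat_adjoint (U * A * mat_adjoint U) = U * mat_adjoint A * mat_adjoint U"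
  using assms unitary_c_carrier[OF U]
  by (simp add: mat_adjoint_mult[of _ n n _ n] assoc_mult_mat[of _ n n _ n _ n])

end

text \<open>\<open>l j\<close> is the value of the quadratic form at the eigenvector
  \<open>col U j\<close>.\<close>

lemma psd_spectral_nonneg:
  assumes W: "psd_mat n W" and sd: "spectral_decomp n W U l" and j: "j < n"
  shows "0 \<le> l j"
proof -
  have U: "unitary_c n U" and Weq: "W = U * mat_diag n (\<lambda>j. complex_of_real (l j)) * mat_adjoint U"
    using sd by (auto simp: spectral_decomp_def)
  have Uc: "U \<in> carrier_mat n n" using U by (rule unitary_c_carrier)
  have "(W *\<^sub>v col U j) \<bullet>c col U j = (mat_adjoint U * W * U) $$ (j,j)"
    using adjoint_conj_index[OF Uc psd_mat_carrier[OF W] j j] by simp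
  also have "mat_adjoint U * W * U = mat_diag n (\<lambda>j. complex_of_real (l j))"
    unfolding Weq by (rule adjoint_conj_unitary_conj[OF U]) simp
  finally have "(W *\<^sub>v col U j) \<bullet>c col U j = complex_of_real (l j)"
    using j by (simp add: mat_diag_def)
  moreover have "0 \<le> Re ((W *\<^sub>v col U j) \<bullet>c col U j)"
    using W Uc j by (auto simp: psd_mat_def)
  ultimately show ?thesis by simp
qed

text \<open>The factor is \<open>U\<close> times the diagonal matrix of square roots of the
  eigenvalues.\<close>

lemma psd_mat_factor:
  assumes W: "psd_mat n W"
  shows "\<exists>A \<in> carrier_mat n n. W = A * mat_adjoint A"
proof -
  obtain U l where sd: "spectral_decomp n W U l"
    using hermitian_spectral_decomp[OF psd_mat_carrier[OF W] psd_mat_hermitian[OF W]] by blast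
  have U: "unitary_c n U" and Weq: "W = U * mat_diag n (\<lambda>j. complex_of_real (l j)) * mat_adjoint U"
    using sd by (auto simp: spectral_decomp_def)
  have Uc: "U \<in> carrier_mat n n" using U by (rule unitary_c_carrier)
  define S where "S = mat_diag n (\<lambda>j. complex_of_real (sqrt (l j)))"
  have S: "S \<in> carrier_mat n n" by (simp add: S_def)
  have Sh: "mat_adjoint S = S" by (rule hermitianI[OF S]) (auto simp: S_def mat_diag_def)
  have SS: "S * S = mat_diag n (\<lambda>j. complex_of_real (l j))"
    unfolding S_def mat_diag_diag
    by (rule eq_matI)
      (auto simp: mat_diag_def psd_spectral_nonneg[OF W sd] simp flip: of_real_mult)
  have "(U * S) * mat_adjoint (U * S) = W"
    unfolding Weq SS[symmetric] mat_adjoint_mult[OF Uc S] Sh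
    using Uc S by (simp add: assoc_mult_mat[of _ n n _ n _ n])
  then show ?thesis using Uc S by (metis mult_carrier_mat_square)
qed

text \<open>Factor \<open>W\<close> as \<open>A * mat_adjoint A\<close>; by cyclicity the trace is
  the squared Hilbert-Schmidt norm of \<open>H * A\<close>.\<close>

lemma trace_c_psd_square_nonneg:
  assumes W: "psd_mat n W" and H: "H \<in> carrier_mat n n" "mat_adjoint H = H"
  shows "0 \<le> Re (trace_c (W * (H * H)))"
proof -
  obtain A where A: "A \<in> carrier_mat n n" and Weq: "W = A * mat_adjoint A"
    using psd_mat_factor[OF W] by blast
  have "trace_c (W * (H * H)) = trace_c (A * (mat_adjoint A * (H * H)))"
    unfolding Weq using A H by (simp add: assoc_mult_mat[of _ n n _ n _ n])
  also have "\<dots> = trace_c (mat_adjoint A * (H * H) * A)"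
    using A H by (intro trace_c_comm) auto
  also have "mat_adjoint A * (H * H) * A = mat_adjoint (H * A) * (H * A)"
    using A H by (simp add: mat_adjoint_mult[of _ n n _ n] assoc_mult_mat[of _ n n _ n _ n])
  also have "trace_c \<dots> = complex_of_real (\<Sum>i<n. \<Sum>j<n. (cmod ((H * A) $$ (j,i)))\<^sup>2)"
    by (rule trace_c_adjoint_mult_self) (use A H in auto)
  finally show ?thesis by (simp add: sum_nonneg)
qed

text \<open>Expand the nonnegative number \<open>tr (W (X - M)\<^sup>2)\<close>.\<close>

lemma trace_c_square_completion:
  assumes W: "psd_mat n W" and X: "X \<in> carrier_mat n n" "mat_adjoint X = X"
    and M: "M \<in> carrier_mat n n" "mat_adjoint M = M"
  shows "Re (trace_c ((W * M + M * W) * X)) - Re (trace_c (W * (M * M))) \<le> Re (trace_c (W * (X * X)))"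
proof -
  have Wc: "W \<in> carrier_mat n n" using W by (rule psd_mat_carrier)
  have XM: "X - M \<in> carrier_mat n n" using X M by auto
  have "(X - M) * (X - M) = X * (X - M) - M * (X - M)"
    by (rule minus_mult_distrib_mat[OF X(1) M(1) XM])
  also have "\<dots> = (X * X - X * M) - (M * X - M * M)"
    unfolding mult_minus_distrib_mat[OF X(1) X(1) M(1)] mult_minus_distrib_mat[OF M(1) X(1) M(1)] ..
  finally have "W * ((X - M) * (X - M)) = W * ((X * X - X * M) - (M * X - M * M))" by simp
  also have "\<dots> = W * (X * X - X * M) - W * (M * X - M * M)"
    by (rule mult_minus_distrib_mat[of _ n n _ n]) (use X M Wc in auto)
  also have "W * (X * X - X * M) = W * (X * X) - W * (X * M)"
    by (rule mult_minus_distrib_mat[of _ n n _ n]) (use X M Wc in auto)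
  also have "W * (M * X - M * M) = W * (M * X) - W * (M * M)"
    by (rule mult_minus_distrib_mat[of _ n n _ n]) (use X M Wc in auto)
  finally have e: "W * ((X - M) * (X - M)) = W * (X * X) - W * (X * M) - (W * (M * X) - W * (M * M))" .
  \<comment> \<open>Cyclicity lets the two cross terms combine into the trace of
    \<open>(W * M + M * W) * X\<close>, where the anticommutator can later be replaced through the
    equation for a logarithmic derivative.\<close>
  have t1: "trace_c (W * (X * M)) = trace_c (M * W * X)"
    using trace_c_comm[of "W * X" n n M] X M Wc by (simp add: assoc_mult_mat[of _ n n _ n _ n])
  have "(W * M + M * W) * X = W * M * X + M * W * X"
    using X M Wc by (intro add_mult_distrib_mat) auto
  then have t2: "trace_c ((W * M + M * W) * X) = trace_c (W * (M * X)) + trace_c (M * W * X)"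
    using X M Wc by (simp add: trace_c_add[of _ n] assoc_mult_mat[of _ n n _ n _ n])
  have "trace_c (W * ((X - M) * (X - M))) = trace_c (W * (X * X)) - trace_c (W * (X * M))
      - (trace_c (W * (M * X)) - trace_c (W * (M * M)))"
    unfolding e using X M Wc by (simp add: trace_c_minus[of _ n] minus_carrier_mat)
  moreover have "0 \<le> Re (trace_c (W * ((X - M) * (X - M))))"
    using X M by (intro trace_c_psd_square_nonneg[OF W]) (auto simp: mat_adjoint_minus[of _ n n])
  ultimately show ?thesis unfolding t1 t2 by simp
qed

subsection \<open>The SLD Fisher information as a supremum\<close>

lemma mat_deriv_carrier [simp]: "mat_deriv n F t \<in> carrier_mat n n"
  by (simp add: mat_deriv_def)

lemma mat_deriv_index:
  assumes "i < n" "j < n" "((\<lambda>s. F s $$ (i,j)) has_vector_derivative d) (at t)"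
  shows "mat_deriv n F t $$ (i,j) = d"
  using assms by (simp add: mat_deriv_def vector_derivative_at)

lemma mat_family_diff_has_derivative:
  assumes "mat_family_diff n F" "i < n" "j < n"
  shows "((\<lambda>s. F s $$ (i,j)) has_vector_derivative mat_deriv n F t $$ (i,j)) (at t)"
  using assms by (simp add: mat_family_diff_def mat_deriv_def vector_derivative_works)

text \<open>Conjugation commutes with the derivative in a real parameter.\<close>

lemma mat_deriv_hermitian:
  assumes "mat_family_diff n F" and "\<And>s. F s \<in> carrier_mat n n" "\<And>s. mat_adjoint (F s) = F s"
  shows "mat_adjoint (mat_deriv n F t) = mat_deriv n F t"
proof (rule hermitianI)
  fix i j assume ij: "i < n" "j < n"
  have "((\<lambda>s. cnj (F s $$ (j,i))) has_vector_derivative cnj (mat_deriv n F t $$ (j,i))) (at t)"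
    by (rule has_vector_derivative_cnj) (rule mat_family_diff_has_derivative[OF assms(1) ij(2,1)])
  moreover have "(\<lambda>s. F s $$ (i,j)) = (\<lambda>s. cnj (F s $$ (j,i)))"
    using hermitian_index[OF assms(2,3) ij] by (rule ext)
  ultimately show "mat_deriv n F t $$ (i,j) = cnj (mat_deriv n F t $$ (j,i))"
    by (intro mat_deriv_index[OF ij]) simp
qed simp

text \<open>Discharges the \<open>SOME\<close> in the definition by the spectral theorem. The kernel
  projection becomes a conjugated 0-1 diagonal matrix, so that it can be multiplied in the
  eigenbasis, and excluded index pairs contribute 0 to a full double sum.\<close>

lemma SLD_fisher_spectral:
  assumes \<rho>: "psd_mat n (F t)"
  obtains U l where "spectral_decomp n (F t) U l"
    "SLD_fisher n F t =
      (let P = U * mat_diag n (\<lambda>j. if l j = 0 then 1 else 0) * mat_adjoint U; D = mat_deriv n F t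
       in if P * D * P \<noteq> 0\<^sub>m n n then \<infinity>
          else ereal (2 * (\<Sum>j<n. \<Sum>k<n. if l j + l k > 0
            then (cmod ((mat_adjoint U * D * U) $$ (j,k)))\<^sup>2 / (l j + l k) else 0)))"
proof -
  define p where "p = (SOME p. spectral_decomp n (F t) (fst p) (snd p))"
  define U where "U = fst p"
  define l where "l = snd p"
  define D where "D = mat_deriv n F t"
  have Dc: "D \<in> carrier_mat n n" by (simp add: D_def)
  have "\<exists>p. spectral_decomp n (F t) (fst p) (snd p)"
    using hermitian_spectral_decomp[OF psd_mat_carrier[OF \<rho>] psd_mat_hermitian[OF \<rho>]] by simp
  then have sd: "spectral_decomp n (F t) U l"
    unfolding U_def l_def p_def by (rule someI_ex)
  have Uc: "U \<in> carrier_mat n n" using sd by (simp add: spectral_decomp_def unitary_c_def)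
  have P: "Matrix.mat n n (\<lambda>(a,b). \<Sum>j\<in>{j. j < n \<and> l j = 0}. U $$ (a,j) * cnj (U $$ (b,j)))
      = U * mat_diag n (\<lambda>j. if l j = 0 then 1 else 0) * mat_adjoint U"
  proof (rule eq_matI)
    fix a b assume "a < dim_row (U * mat_diag n (\<lambda>j. if l j = 0 then 1 else 0) * mat_adjoint U)"
      "b < dim_col (U * mat_diag n (\<lambda>j. if l j = 0 then 1 else 0) * mat_adjoint U)"
    then have ab: "a < n" "b < n" using Uc by auto
    have "(\<Sum>j\<in>{j. j < n \<and> l j = 0}. U $$ (a,j) * cnj (U $$ (b,j)))
        = (\<Sum>j<n. U $$ (a,j) * (if l j = 0 then 1 else 0) * cnj (U $$ (b,j)))"
      by (rule sum.mono_neutral_cong_left) auto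
    then show "Matrix.mat n n (\<lambda>(a,b). \<Sum>j\<in>{j. j < n \<and> l j = 0}. U $$ (a,j) * cnj (U $$ (b,j))) $$ (a,b)
        = (U * mat_diag n (\<lambda>j. if l j = 0 then 1 else 0) * mat_adjoint U) $$ (a,b)"
      unfolding conj_mat_diag_index[OF Uc ab] using ab by simp
  qed (use Uc in auto)
  have S: "(\<Sum>(j,k)\<in>{(j,k). j < n \<and> k < n \<and> l j + l k > 0}.
        (cmod ((D *\<^sub>v col U k) \<bullet>c col U j))\<^sup>2 / (l j + l k))
      = (\<Sum>j<n. \<Sum>k<n. if l j + l k > 0
            then (cmod ((mat_adjoint U * D * U) $$ (j,k)))\<^sup>2 / (l j + l k) else 0)"
    unfolding sum.cartesian_product
    by (rule sum.mono_neutral_cong_left)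
      (auto simp: adjoint_conj_index[OF Uc Dc] simp del: index_mult_mat(1) split: if_splits)
  have "SLD_fisher n F t =
      (let P = U * mat_diag n (\<lambda>j. if l j = 0 then 1 else 0) * mat_adjoint U; D = mat_deriv n F t
       in if P * D * P \<noteq> 0\<^sub>m n n then \<infinity>
          else ereal (2 * (\<Sum>j<n. \<Sum>k<n. if l j + l k > 0
            then (cmod ((mat_adjoint U * D * U) $$ (j,k)))\<^sup>2 / (l j + l k) else 0)))"
    unfolding SLD_fisher_def Let_def p_def[symmetric] U_def[symmetric] l_def[symmetric]
      D_def[symmetric] P S ..
  with sd that show thesis by blast
qed

text \<open>Each case supplies the operator behind the variational form. In the infinite one, the
  kernel block of the derivative is a test direction with no quadratic cost and positive gain; in
  the finite one, the equation for \<open>L\<close> is solved entrywise in the eigenbasis.\<close>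

lemma SLD_fisher_cases:
  assumes \<rho>: "psd_mat n (F t)" and D: "mat_adjoint (mat_deriv n F t) = mat_deriv n F t"
  obtains
    (infinite) X where "SLD_fisher n F t = \<infinity>" "X \<in> carrier_mat n n" "mat_adjoint X = X"
      "trace_c (F t * (X * X)) = 0" "0 < Re (trace_c (mat_deriv n F t * X))"
  | (finite) L where "L \<in> carrier_mat n n" "mat_adjoint L = L"
      "F t * L + L * F t = mat_deriv n F t + mat_deriv n F t"
      "SLD_fisher n F t = ereal (Re (trace_c (mat_deriv n F t * L)))"
proof -
  define D where "D = mat_deriv n F t"
  have Dc: "D \<in> carrier_mat n n" and Dh: "mat_adjoint D = D" using D by (simp_all add: D_def)
  obtain U l where sd: "spectral_decomp n (F t) U l"
    and SLD: "SLD_fisher n F t =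
      (let P = U * mat_diag n (\<lambda>j. if l j = 0 then 1 else 0) * mat_adjoint U; D = mat_deriv n F t
       in if P * D * P \<noteq> 0\<^sub>m n n then \<infinity>
          else ereal (2 * (\<Sum>j<n. \<Sum>k<n. if l j + l k > 0
            then (cmod ((mat_adjoint U * D * U) $$ (j,k)))\<^sup>2 / (l j + l k) else 0)))"
    by (rule SLD_fisher_spectral[where F = F and t = t, OF \<rho>])
  have U: "unitary_c n U" using sd by (simp add: spectral_decomp_def)
  have Uc: "U \<in> carrier_mat n n" using U by (rule unitary_c_carrier)
  define \<Lambda> where "\<Lambda> = mat_diag n (\<lambda>j. complex_of_real (l j))"
  define Q where "Q = mat_diag n (\<lambda>j. if l j = 0 then (1::complex) else 0)"
  have \<Lambda>: "\<Lambda> \<in> carrier_mat n n" and Q: "Q \<in> carrier_mat n n" by (simp_all add: \<Lambda>_def Q_def)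
  have Qh: "mat_adjoint Q = Q" by (rule hermitianI[OF Q]) (auto simp: Q_def mat_diag_def)
  have \<rho>eq: "F t = U * \<Lambda> * mat_adjoint U" using sd by (simp add: spectral_decomp_def \<Lambda>_def)
  define E where "E = mat_adjoint U * D * U"
  have E: "E \<in> carrier_mat n n" using Uc Dc by (simp add: E_def)
  have Deq: "D = U * E * mat_adjoint U"
    unfolding E_def by (rule unitary_conj_adjoint_conj[OF U Dc, symmetric])
  have Eh: "mat_adjoint E = E"
    unfolding E_def using Uc Dc Dh
    by (simp add: mat_adjoint_mult[of _ n n _ n] assoc_mult_mat[of _ n n _ n _ n])
  define P where "P = U * Q * mat_adjoint U"
  define X where "X = P * D * P"
  have Xeq: "X = U * (Q * E * Q) * mat_adjoint U"
    unfolding X_def P_def Deq using Q E by (simp add: unitary_conj_mult[OF U])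
  have SLD': "SLD_fisher n F t = (if X \<noteq> 0\<^sub>m n n then \<infinity>
          else ereal (2 * (\<Sum>j<n. \<Sum>k<n. if l j + l k > 0
            then (cmod (E $$ (j,k)))\<^sup>2 / (l j + l k) else 0)))"
    unfolding SLD Let_def D_def[symmetric] Q_def[symmetric] P_def[symmetric] X_def[symmetric]
      E_def[symmetric] ..
  have Pc: "P \<in> carrier_mat n n" using Uc Q by (simp add: P_def)
  have Ph: "mat_adjoint P = P" unfolding P_def mat_adjoint_unitary_conj[OF U Q] Qh ..
  have PP: "P * P = P"
    unfolding P_def unitary_conj_mult[OF U Q Q] unfolding Q_def mat_diag_diag by (simp add: if_distrib cong: if_cong)
  have Xc: "X \<in> carrier_mat n n" using Pc Dc by (simp add: X_def)
  have Xh: "mat_adjoint X = X"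
    unfolding X_def using Pc Dc Ph Dh
    by (simp add: mat_adjoint_mult[of _ n n _ n] assoc_mult_mat[of _ n n _ n _ n])
  show thesis
  proof (cases "X = 0\<^sub>m n n")
    case False
    have \<Lambda>Q: "\<Lambda> * Q = 0\<^sub>m n n"
      unfolding \<Lambda>_def Q_def mat_diag_diag by (rule eq_matI) (auto simp: mat_diag_def)
    \<comment> \<open>The state kills its kernel projection \<open>P\<close>, and \<open>X\<close>
      begins with \<open>P\<close>, so the quadratic term vanishes.\<close>
    have "F t * P = U * (\<Lambda> * Q) * mat_adjoint U"
      unfolding \<rho>eq P_def by (rule unitary_conj_mult[OF U \<Lambda> Q])
    also have "\<dots> = 0\<^sub>m n n" unfolding \<Lambda>Q using Uc by simp
    finally have FP: "F t * P = 0\<^sub>m n n" .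
    have Fc: "F t \<in> carrier_mat n n" using \<rho> by (rule psd_mat_carrier)
    have "F t * (X * X) = (F t * P) * (D * P * X)"
      unfolding X_def using Fc Pc Dc by (simp add: assoc_mult_mat[of _ n n _ n _ n])
    also have "\<dots> = 0\<^sub>m n n" unfolding FP using Pc Dc Xc by (intro left_mult_zero_mat) auto
    finally have z: "trace_c (F t * (X * X)) = 0" by (simp add: trace_c_def)
    \<comment> \<open>Cyclicity and \<open>P * P = P\<close> turn the trace of \<open>X * X\<close>
      into that of \<open>D * X\<close>. As \<open>X\<close> is Hermitian and nonzero, this is a
      positive squared norm.\<close>
    have "trace_c (X * X) = trace_c (P * (D * P * X))"
      unfolding X_def using Pc Dc by (simp add: assoc_mult_mat[of _ n n _ n _ n])
    also have "\<dots> = trace_c (D * P * X * P)"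
      using Pc Dc Xc by (intro trace_c_comm) auto
    also have "D * P * X * P = D * (P * P) * D * (P * P)"
      unfolding X_def using Pc Dc by (simp add: assoc_mult_mat[of _ n n _ n _ n])
    also have "\<dots> = D * X"
      unfolding PP X_def using Pc Dc by (simp add: assoc_mult_mat[of _ n n _ n _ n])
    finally have "trace_c (D * X) = trace_c (mat_adjoint X * X)" using Xh by simp
    also have "\<dots> = complex_of_real (\<Sum>i<n. \<Sum>j<n. (cmod (X $$ (j,i)))\<^sup>2)"
      by (rule trace_c_adjoint_mult_self[OF Xc])
    finally have tr: "Re (trace_c (D * X)) = (\<Sum>i<n. \<Sum>j<n. (cmod (X $$ (j,i)))\<^sup>2)" by simp
    obtain a b where ab: "a < n" "b < n" "X $$ (a,b) \<noteq> 0"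
      using False Xc by (metis eq_matI carrier_matD index_zero_mat)
    have "0 < (\<Sum>j<n. (cmod (X $$ (j,b)))\<^sup>2)"
      by (rule sum_pos2[of _ a]) (use ab in auto)
    then have "0 < (\<Sum>i<n. \<Sum>j<n. (cmod (X $$ (j,i)))\<^sup>2)"
      by (intro sum_pos2[of "{..<n}" b "\<lambda>i. \<Sum>j<n. (cmod (X $$ (j,i)))\<^sup>2"])
        (use ab in \<open>auto intro: sum_nonneg\<close>)
    then show thesis
      using infinite[of X] SLD' False Xc Xh z tr by (simp add: D_def)
  next
    case True
    \<comment> \<open>Vanishing of \<open>X\<close> means that \<open>E\<close> is zero on the
      kernel block, the only place where the equation for \<open>K\<close> cannot be solved by
      division.\<close>
    have E0: "E $$ (j,k) = 0" if "j < n" "k < n" "l j = 0" "l k = 0" for j k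
    proof -
      have "Q * E * Q = mat_adjoint U * X * U"
        unfolding Xeq using adjoint_conj_unitary_conj[OF U, of "Q * E * Q"] Q E by simp
      also have "\<dots> = 0\<^sub>m n n" unfolding True using Uc by simp
      finally have "(Q * E * Q) $$ (j,k) = 0" using that by simp
      moreover have "(Q * E * Q) $$ (j,k) = E $$ (j,k)"
        unfolding Q_def mat_diag_mult_left[OF E] using that E
        by (subst mat_diag_mult_right[of _ n]) auto
      ultimately show ?thesis by simp
    qed
    have l0: "0 \<le> l j" if "j < n" for j using psd_spectral_nonneg[OF \<rho> sd that] .
    \<comment> \<open>In the eigenbasis the equation reads
      \<open>(l j + l k) * K $$ (j,k) = 2 * E $$ (j,k)\<close>. Where both eigenvalues vanish the
      entry is free, and 0 keeps \<open>K\<close> Hermitian.\<close>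
    define K where "K = Matrix.mat n n (\<lambda>(j,k). if l j + l k > 0
      then 2 * E $$ (j,k) / complex_of_real (l j + l k) else 0)"
    have K: "K \<in> carrier_mat n n" by (simp add: K_def)
    have Kh: "mat_adjoint K = K"
    proof (rule hermitianI[OF K])
      fix i j assume ij: "i < n" "j < n"
      show "K $$ (i,j) = cnj (K $$ (j,i))"
        using ij hermitian_index[OF E Eh ij] by (simp add: K_def add.commute)
    qed
    have \<Lambda>K: "\<Lambda> * K + K * \<Lambda> = E + E"
    proof (rule eq_matI)
      fix j k assume "j < dim_row (E + E)" "k < dim_col (E + E)"
      then have jk: "j < n" "k < n" using E by auto
      have "(\<Lambda> * K + K * \<Lambda>) $$ (j,k) = complex_of_real (l j + l k) * K $$ (j,k)"
        unfolding \<Lambda>_def mat_diag_mult_left[OF K] mat_diag_mult_right[OF K]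
        using jk by (simp add: algebra_simps)
      also have "\<dots> = (E + E) $$ (j,k)"
      proof (cases "l j + l k > 0")
        case True
        then have "complex_of_real (l j + l k) \<noteq> 0" by (metis less_irrefl of_real_eq_0_iff)
        then show ?thesis using jk E True by (simp add: K_def)
      next
        case False
        then have "l j = 0" "l k = 0" using l0[OF jk(1)] l0[OF jk(2)] by auto
        then show ?thesis using jk E E0[OF jk] by simp
      qed
      finally show "(\<Lambda> * K + K * \<Lambda>) $$ (j,k) = (E + E) $$ (j,k)" .
    qed (use E K \<Lambda> in auto)
    define L where "L = U * K * mat_adjoint U"
    have Lc: "L \<in> carrier_mat n n" using Uc K by (simp add: L_def)
    have Lh: "mat_adjoint L = L" unfolding L_def mat_adjoint_unitary_conj[OF U K] Kh ..
    have "F t * L + L * F t = U * (\<Lambda> * K + K * \<Lambda>) * mat_adjoint U"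
      unfolding \<rho>eq L_def using \<Lambda> K by (simp add: unitary_conj_mult[OF U] unitary_conj_add[OF U])
    also have "\<dots> = D + D"
      unfolding \<Lambda>K Deq by (rule unitary_conj_add[OF U E E, symmetric])
    finally have FL: "F t * L + L * F t = D + D" .
    have "trace_c (D * L) = trace_c (E * K)"
      unfolding Deq L_def unitary_conj_mult[OF U E K] using E K
      by (intro trace_c_unitary_conj[OF U]) simp
    also have "\<dots> = (\<Sum>j<n. \<Sum>k<n. complex_of_real (if l j + l k > 0
            then 2 * ((cmod (E $$ (j,k)))\<^sup>2 / (l j + l k)) else 0))"
      unfolding trace_c_mult[OF E K]
    proof (intro sum.cong refl)
      fix j k assume "j \<in> {..<n}" "k \<in> {..<n}"
      then have jk: "j < n" "k < n" by auto
      have "E $$ (j,k) * E $$ (k,j) = complex_of_real ((cmod (E $$ (j,k)))\<^sup>2)"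
        using hermitian_index[OF E Eh jk(2,1)] by (simp only: complex_norm_square)
      then show "E $$ (j,k) * K $$ (k,j) = complex_of_real (if l j + l k > 0
            then 2 * ((cmod (E $$ (j,k)))\<^sup>2 / (l j + l k)) else 0)"
        using jk by (simp add: K_def add.commute)
    qed
    finally have "Re (trace_c (D * L)) = (\<Sum>j<n. \<Sum>k<n. if l j + l k > 0
            then 2 * ((cmod (E $$ (j,k)))\<^sup>2 / (l j + l k)) else 0)"
      by (simp only: flip: of_real_sum) simp
    also have "\<dots> = 2 * (\<Sum>j<n. \<Sum>k<n. if l j + l k > 0
            then (cmod (E $$ (j,k)))\<^sup>2 / (l j + l k) else 0)"
      unfolding sum_distrib_left by (intro sum.cong refl) simp
    finally have "SLD_fisher n F t = ereal (Re (trace_c (D * L)))"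
      using SLD' True by simp
    then show thesis using finite[of L] Lc Lh FL by (simp add: D_def)
  qed
qed

text \<open>Multiply the equation by \<open>L\<close> on the right and take traces: by cyclicity
  both terms on the left have the same trace. Thus the test operator \<open>L\<close> attains the
  value of the Fisher information.\<close>

lemma trace_c_SLD_square:
  assumes c: "\<rho> \<in> carrier_mat n n" "L \<in> carrier_mat n n" "D \<in> carrier_mat n n"
    and eq: "\<rho> * L + L * \<rho> = D + D"
  shows "trace_c (\<rho> * (L * L)) = trace_c (D * L)"
proof -
  have "trace_c ((\<rho> * L + L * \<rho>) * L) = trace_c (\<rho> * L * L) + trace_c (L * \<rho> * L)"
    using c by (simp add: add_mult_distrib_mat[of _ n n _ _ n] trace_c_add[of _ n])
  also have "trace_c (L * \<rho> * L) = trace_c (\<rho> * (L * L))"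
    using trace_c_comm[of L n n "\<rho> * L"] c by (simp add: assoc_mult_mat[of _ n n _ n _ n])
  also have "\<rho> * L * L = \<rho> * (L * L)" using c by (simp add: assoc_mult_mat[of _ n n _ n _ n])
  also have "(\<rho> * L + L * \<rho>) * L = D * L + D * L"
    unfolding eq using c by (simp add: add_mult_distrib_mat[of _ n n _ _ n])
  finally show ?thesis using c by (simp add: trace_c_add[of _ n])
qed

text \<open>In the finite case, test with \<open>L\<close>. In the infinite case, scaling
  \<open>X\<close> makes the linear term arbitrarily large while the quadratic term stays 0, so no
  real bound \<open>C\<close> could hold.\<close>

lemma SLD_fisher_leI:
  assumes \<rho>: "psd_mat n (F t)" and D: "mat_adjoint (mat_deriv n F t) = mat_deriv n F t"
    and le: "\<And>X. X \<in> carrier_mat n n \<Longrightarrow> mat_adjoint X = X \<Longrightarrow>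
      2 * Re (trace_c (mat_deriv n F t * X)) - Re (trace_c (F t * (X * X))) \<le> C"
  shows "SLD_fisher n F t \<le> ereal C"
proof (cases rule: SLD_fisher_cases[where F = F and t = t, OF \<rho> D, case_names infinite finite])
  case (infinite X)
  define y where "y = Re (trace_c (mat_deriv n F t * X))"
  \<comment> \<open>Chosen so that \<open>c * y\<close> is \<open>\<bar>C\<bar> + 1\<close>, whose
    double exceeds \<open>C\<close>.\<close>
  define c where "c = (\<bar>C\<bar> + 1) / y"
  have y: "0 < y" using infinite by (simp add: y_def)
  let ?X = "complex_of_real c \<cdot>\<^sub>m X"
  have c1: "mat_deriv n F t * ?X = complex_of_real c \<cdot>\<^sub>m (mat_deriv n F t * X)"
    by (rule mult_smult_distrib[OF mat_deriv_carrier infinite(2)])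
  have sm: "a \<cdot>\<^sub>m (b \<cdot>\<^sub>m A) = (a * b) \<cdot>\<^sub>m A" for a b and A :: "complex mat"
    by (rule eq_matI) auto
  have c2: "F t * (?X * ?X) = complex_of_real (c * c) \<cdot>\<^sub>m (F t * (X * X))"
    using infinite psd_mat_carrier[OF \<rho>]
    by (simp add: mult_smult_distrib[of _ n n _ n] mult_smult_assoc_mat[of _ n n _ n] sm)
  have tr: "trace_c (a \<cdot>\<^sub>m A) = a * trace_c A" if "A \<in> carrier_mat n n" for a A
    using that by (simp add: trace_c_def sum_distrib_left)
  have "mat_adjoint ?X = ?X"
  proof (rule hermitianI)
    fix i j assume ij: "i < n" "j < n"
    show "?X $$ (i,j) = cnj (?X $$ (j,i))"
      using hermitian_index[OF infinite(2,3) ij] ij infinite(2) by simp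
  qed (use infinite in auto)
  from le[OF _ this] have "2 * (c * y) \<le> C"
    using infinite psd_mat_carrier[OF \<rho>] by (simp add: c1 c2 tr y_def)
  then show ?thesis using y by (simp add: c_def)
next
  case (finite L)
  have "trace_c (F t * (L * L)) = trace_c (mat_deriv n F t * L)"
    by (rule trace_c_SLD_square) (use finite psd_mat_carrier[OF \<rho>] in auto)
  then show ?thesis using le[of L] finite by simp
qed

text \<open>The other half of the variational form, for states with a logarithmic derivative: square
  completion around \<open>L\<close>, whose anticommutator with the state is twice the
  derivative.\<close>

lemma SLD_fisher_ge:
  assumes \<rho>: "psd_mat n (F t)"
    and L: "L \<in> carrier_mat n n" "mat_adjoint L = L"
      "F t * L + L * F t = mat_deriv n F t + mat_deriv n F t"
    and X: "X \<in> carrier_mat n n" "mat_adjoint X = X"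
  shows "2 * Re (trace_c (mat_deriv n F t * X)) - Re (trace_c (F t * (X * X)))
    \<le> Re (trace_c (mat_deriv n F t * L))"
proof -
  note c = psd_mat_carrier[OF \<rho>] L(1) X(1)
  have "Re (trace_c ((F t * L + L * F t) * X)) - Re (trace_c (F t * (L * L)))
      \<le> Re (trace_c (F t * (X * X)))"
    by (rule trace_c_square_completion[OF \<rho> X L(1,2)])
  moreover have "trace_c (F t * (L * L)) = trace_c (mat_deriv n F t * L)"
    by (rule trace_c_SLD_square) (use L c in auto)
  moreover have "trace_c ((F t * L + L * F t) * X) = 2 * trace_c (mat_deriv n F t * X)"
    unfolding L(3) using c by (simp add: add_mult_distrib_mat[of _ n n _ _ n] trace_c_add[of _ n])
  ultimately show ?thesis by simp
qed

subsection \<open>Kronecker products\<close>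

lemma tensor_index_less: "i < r \<Longrightarrow> a < d \<Longrightarrow> i * d + a < r * (d::nat)"
  by (metis div_less_iff_less_mult div_mult_self3 div_less add.commute add.right_neutral mult_0_right not_gr_zero)

lemma tensor_index_cases:
  assumes "p < r * d"
  obtains i a where "i < r" "a < d" "p = i * d + (a::nat)"
proof -
  have "0 < d" using assms by (cases d) auto
  then show thesis
    using that[of "p div d" "p mod d"] assms by (simp add: less_mult_imp_div_less)
qed

lemma sum_tensor_index: "(\<Sum>p<r * d. f p) = (\<Sum>i<r. \<Sum>a<d. f (i * d + a :: nat))"
proof -
  have "(\<Sum>p<r * d. f p) = (\<Sum>i<r. sum f {i * d..<i * d + d})"
    by (rule sum.nat_group[symmetric])
  also have "\<dots> = (\<Sum>i<r. \<Sum>a<d. f (i * d + a))"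
  proof (rule sum.cong[OF refl])
    fix i show "sum f {i * d..<i * d + d} = (\<Sum>a<d. f (i * d + a))"
      using sum.shift_bounds_nat_ivl[of f 0 "i * d" d]
      by (simp add: atLeast0LessThan add.commute)
  qed
  finally show ?thesis .
qed

lemma tensor_mat_eqI:
  assumes "A \<in> carrier_mat (r * d) (r * d)" "B \<in> carrier_mat (r * d) (r * d)"
    and eq: "\<And>i j a b. i < r \<Longrightarrow> j < r \<Longrightarrow> a < d \<Longrightarrow> b < d \<Longrightarrow>
      A $$ (i * d + a, j * d + b) = B $$ (i * d + a, j * d + b)"
  shows "A = B"
proof (rule eq_matI)
  fix p q assume "p < dim_row B" "q < dim_col B"
  then have "p < r * d" "q < r * d" using assms by auto
  then show "A $$ (p,q) = B $$ (p,q)" by (elim tensor_index_cases) (simp add: eq)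
qed (use assms in auto)

definition kron :: "complex mat \<Rightarrow> complex mat \<Rightarrow> complex mat" where
  "kron A B = Matrix.mat (dim_row A * dim_row B) (dim_col A * dim_col B)
    (\<lambda>(p,q). A $$ (p div dim_row B, q div dim_col B) * B $$ (p mod dim_row B, q mod dim_col B))"

lemma kron_dim [simp]:
  "dim_row (kron A B) = dim_row A * dim_row B" "dim_col (kron A B) = dim_col A * dim_col B"
  by (simp_all add: kron_def)

context
  fixes r d :: nat
begin

lemma kron_carrier [simp]:
  "A \<in> carrier_mat r r \<Longrightarrow> B \<in> carrier_mat d d \<Longrightarrow> kron A B \<in> carrier_mat (r * d) (r * d)"
  by (auto simp: kron_def)

lemma kron_index:
  assumes "A \<in> carrier_mat r r" "B \<in> carrier_mat d d" "i < r" "j < r" "a < d" "b < d"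
  shows "kron A B $$ (i * d + a, j * d + b) = A $$ (i,j) * B $$ (a,b)"
  using assms tensor_index_less[of i r a d] tensor_index_less[of j r b d]
  by (auto simp: kron_def)

lemma kron_mult:
  assumes c: "A \<in> carrier_mat r r" "B \<in> carrier_mat d d" "C \<in> carrier_mat r r" "D \<in> carrier_mat d d"
  shows "kron A B * kron C D = kron (A * C) (B * D)"
proof (rule tensor_mat_eqI[of _ r d])
  fix i j a b assume h: "i < r" "j < r" "a < d" "b < d"
  have "(kron A B * kron C D) $$ (i * d + a, j * d + b)
      = (\<Sum>p<r * d. kron A B $$ (i * d + a, p) * kron C D $$ (p, j * d + b))"
    by (rule mult_mat_index[OF kron_carrier[OF c(1,2)] kron_carrier[OF c(3,4)]
          tensor_index_less[OF h(1,3)] tensor_index_less[OF h(2,4)]])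
  also have "\<dots> = (\<Sum>k<r. \<Sum>e<d. (A $$ (i,k) * C $$ (k,j)) * (B $$ (a,e) * D $$ (e,b)))"
    unfolding sum_tensor_index using c h
    by (intro sum.cong refl) (simp add: kron_index mult.assoc mult.left_commute)
  also have "\<dots> = (A * C) $$ (i,j) * (B * D) $$ (a,b)"
    unfolding mult_mat_index[OF c(1,3) h(1,2)] mult_mat_index[OF c(2,4) h(3,4)] sum_product ..
  finally show "(kron A B * kron C D) $$ (i * d + a, j * d + b)
      = kron (A * C) (B * D) $$ (i * d + a, j * d + b)"
    using c h by (simp add: kron_index del: index_mult_mat(1))
qed (use c in auto)

lemma kron_add_right:
  assumes "A \<in> carrier_mat r r" "B \<in> carrier_mat d d" "C \<in> carrier_mat d d"
  shows "kron A (B + C) = kron A B + kron A C"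
  by (rule tensor_mat_eqI[of _ r d])
    (use assms tensor_index_less[of _ r _ d] in \<open>auto simp: kron_index distrib_left distrib_right\<close>)

lemma mat_adjoint_kron:
  assumes "A \<in> carrier_mat r r" "B \<in> carrier_mat d d"
  shows "mat_adjoint (kron A B) = kron (mat_adjoint A) (mat_adjoint B)"
proof (rule tensor_mat_eqI[of _ r d])
  fix i j a b assume h: "i < r" "j < r" "a < d" "b < d"
  have "mat_adjoint (kron A B) $$ (i * d + a, j * d + b) = cnj (kron A B $$ (j * d + b, i * d + a))"
    by (rule mat_adjoint_index) (use assms h tensor_index_less in \<open>simp_all add: kron_def\<close>)
  then show "mat_adjoint (kron A B) $$ (i * d + a, j * d + b)
      = kron (mat_adjoint A) (mat_adjoint B) $$ (i * d + a, j * d + b)"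
    using assms h by (simp add: kron_index)
qed (use assms in auto)

lemma trace_c_kron:
  assumes "A \<in> carrier_mat r r" "B \<in> carrier_mat d d"
  shows "trace_c (kron A B) = trace_c A * trace_c B"
proof -
  have "trace_c (kron A B) = (\<Sum>p<r * d. kron A B $$ (p,p))"
    using assms by (simp add: trace_c_def kron_def)
  also have "\<dots> = (\<Sum>i<r. \<Sum>a<d. A $$ (i,i) * B $$ (a,a))"
    unfolding sum_tensor_index using assms by (intro sum.cong refl) (simp add: kron_index)
  finally show ?thesis using assms by (simp add: trace_c_def sum_product)
qed

text \<open>The Kronecker product of factors of \<open>P\<close> and \<open>W\<close> is a factor of
  \<open>kron P W\<close>.\<close>

lemma psd_mat_kron:
  assumes "psd_mat r P" "psd_mat d W"
  shows "psd_mat (r * d) (kron P W)"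
proof -
  obtain A where A: "A \<in> carrier_mat r r" "P = A * mat_adjoint A" using psd_mat_factor[OF assms(1)] by blast
  obtain B where B: "B \<in> carrier_mat d d" "W = B * mat_adjoint B" using psd_mat_factor[OF assms(2)] by blast
  have "kron P W = kron A B * mat_adjoint (kron A B)"
    unfolding A B mat_adjoint_kron[OF A(1) B(1)] using A B by (simp add: kron_mult)
  then show ?thesis using psd_mat_mult_adjoint[of "kron A B"] A B by simp
qed

text \<open>Partial trace over the second factor of \<open>(1 \<otimes> W) X\<close>.\<close>

definition weighted_ptrace :: "complex mat \<Rightarrow> complex mat \<Rightarrow> complex mat" where
  "weighted_ptrace W X = Matrix.mat r r (\<lambda>(i,j). \<Sum>a<d. \<Sum>b<d. W $$ (a,b) * X $$ (i * d + b, j * d + a))"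

lemma weighted_ptrace_carrier [simp]: "weighted_ptrace W X \<in> carrier_mat r r"
  by (simp add: weighted_ptrace_def)

text \<open>(1 \<otimes> W) X need not be Hermitian, but the partial trace is cyclic for operators
  on the traced factor. In entries, this is the exchange of the two summation indices.\<close>

lemma weighted_ptrace_hermitian:
  assumes W: "W \<in> carrier_mat d d" "mat_adjoint W = W"
    and X: "X \<in> carrier_mat (r * d) (r * d)" "mat_adjoint X = X"
  shows "mat_adjoint (weighted_ptrace W X) = weighted_ptrace W X"
proof (rule hermitianI)
  fix i j assume ij: "i < r" "j < r"
  have "(\<Sum>a<d. \<Sum>b<d. W $$ (a,b) * X $$ (i * d + b, j * d + a))
      = (\<Sum>b<d. \<Sum>a<d. W $$ (a,b) * X $$ (i * d + b, j * d + a))"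
    by (rule sum.swap)
  also have "\<dots> = (\<Sum>b<d. \<Sum>a<d. cnj (W $$ (b,a) * X $$ (j * d + a, i * d + b)))"
  proof (intro sum.cong refl)
    fix b a assume "b \<in> {..<d}" "a \<in> {..<d}"
    then have ab: "a < d" "b < d" by auto
    show "W $$ (a,b) * X $$ (i * d + b, j * d + a) = cnj (W $$ (b,a) * X $$ (j * d + a, i * d + b))"
      unfolding complex_cnj_mult
      using hermitian_index[OF W ab]
        hermitian_index[OF X tensor_index_less[OF ij(1) ab(2)] tensor_index_less[OF ij(2) ab(1)]]
      by metis
  qed
  finally show "weighted_ptrace W X $$ (i,j) = cnj (weighted_ptrace W X $$ (j,i))"
    using ij by (simp add: weighted_ptrace_def)
qed simp

text \<open>The duality that motivates \<open>weighted_ptrace\<close>: under the trace pairing it is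
  the transpose of tensoring with \<open>W\<close>, so traces on the composite system reduce to the
  first factor.\<close>

lemma trace_c_kron_mult:
  assumes A: "A \<in> carrier_mat r r" and W: "W \<in> carrier_mat d d" and X: "X \<in> carrier_mat (r * d) (r * d)"
  shows "trace_c (kron A W * X) = trace_c (A * weighted_ptrace W X)"
proof -
  have "trace_c (kron A W * X) = (\<Sum>p<r * d. \<Sum>q<r * d. kron A W $$ (p,q) * X $$ (q,p))"
    by (rule trace_c_mult) (use A W X in auto)
  also have "\<dots> = (\<Sum>i<r. \<Sum>a<d. \<Sum>j<r. \<Sum>b<d. A $$ (i,j) * (W $$ (a,b) * X $$ (j * d + b, i * d + a)))"
    unfolding sum_tensor_index using A W by (intro sum.cong refl) (simp add: kron_index mult.assoc)
  also have "\<dots> = (\<Sum>i<r. \<Sum>j<r. \<Sum>a<d. \<Sum>b<d. A $$ (i,j) * (W $$ (a,b) * X $$ (j * d + b, i * d + a)))"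
    by (intro sum.cong refl sum.swap)
  also have "\<dots> = (\<Sum>i<r. \<Sum>j<r. A $$ (i,j) * weighted_ptrace W X $$ (j,i))"
    by (intro sum.cong refl) (simp add: weighted_ptrace_def sum_distrib_left)
  also have "\<dots> = trace_c (A * weighted_ptrace W X)"
    by (rule trace_c_mult[symmetric]) (use A in auto)
  finally show ?thesis .
qed

text \<open>Square completion around \<open>Y \<otimes> 1 + 1 \<otimes> L\<close>, where \<open>Y\<close> is the conditional expectation of
  \<open>X\<close> under \<open>W\<close> and \<open>L\<close> is the logarithmic derivative of \<open>W\<close>; the cross term vanishes because
  \<open>tr (W L) = tr D = 0\<close>.\<close>

lemma trace_c_kron_square_completion:
  assumes P: "psd_mat r P" and W: "psd_mat d W" "trace_c W = 1"
    and L: "L \<in> carrier_mat d d" "mat_adjoint L = L" "W * L + L * W = D + D"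
    and D: "D \<in> carrier_mat d d" "trace_c D = 0"
    and X: "X \<in> carrier_mat (r * d) (r * d)" "mat_adjoint X = X"
  defines "Y \<equiv> weighted_ptrace W X"
  shows "Re (trace_c (P * (Y * Y))) + 2 * Re (trace_c (kron P D * X))
      - Re (trace_c P) * Re (trace_c (D * L)) \<le> Re (trace_c (kron P W * (X * X)))"
proof -
  note Pc = psd_mat_carrier[OF P] note Wc = psd_mat_carrier[OF W(1)]
  have Y: "Y \<in> carrier_mat r r" by (simp add: Y_def)
  have Yh: "mat_adjoint Y = Y"
    unfolding Y_def by (rule weighted_ptrace_hermitian[OF Wc psd_mat_hermitian[OF W(1)] X])
  define M where "M = kron Y (1\<^sub>m d) + kron (1\<^sub>m r) L"
  have M: "M \<in> carrier_mat (r * d) (r * d)" using Y L by (simp add: M_def)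
  have one: "mat_adjoint (1\<^sub>m n) = (1\<^sub>m n :: complex mat)" for n
    by (rule hermitianI) auto
  have Mh: "mat_adjoint M = M"
    unfolding M_def using Y L
    by (simp add: mat_adjoint_add[of _ "r * d" "r * d"] mat_adjoint_kron Yh one)
  have KM: "kron A B * M = kron (A * Y) B + kron A (B * L)"
    if "A \<in> carrier_mat r r" "B \<in> carrier_mat d d" for A B
    unfolding M_def using that Y L
    by (simp add: mult_add_distrib_mat[of _ "r * d" "r * d" _ "r * d"] kron_mult)
  have MK: "M * kron A B = kron (Y * A) B + kron A (L * B)"
    if "A \<in> carrier_mat r r" "B \<in> carrier_mat d d" for A B
    unfolding M_def using that Y L
    by (simp add: add_mult_distrib_mat[of _ "r * d" "r * d" _ _ "r * d"] kron_mult)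
  have trX: "trace_c ((A + B) * X) = trace_c (A * X) + trace_c (B * X)"
    if "A \<in> carrier_mat (r * d) (r * d)" "B \<in> carrier_mat (r * d) (r * d)" for A B
    using that X
    by (simp add: add_mult_distrib_mat[of _ "r * d" "r * d" _ _ "r * d"] trace_c_add[of _ "r * d"])
  have YPY: "trace_c (Y * P * Y) = trace_c (P * (Y * Y))"
    using trace_c_comm[of Y r r "P * Y"] Pc Y by (simp add: assoc_mult_mat[of _ r r _ r _ r])
  have "trace_c ((kron P W * M + M * kron P W) * X)
      = trace_c (kron (P * Y) W * X) + trace_c (kron P (W * L) * X)
      + (trace_c (kron (Y * P) W * X) + trace_c (kron P (L * W) * X))"
    using Pc Wc Y L by (simp add: KM MK trX)
  also have "trace_c (kron (P * Y) W * X) = trace_c (P * (Y * Y))"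
    unfolding Y_def[symmetric] using Pc Wc Y X
    by (simp add: trace_c_kron_mult assoc_mult_mat[of _ r r _ r _ r] flip: Y_def)
  also have "trace_c (kron (Y * P) W * X) = trace_c (P * (Y * Y))"
    using Pc Wc Y X YPY by (simp add: trace_c_kron_mult flip: Y_def)
  finally have t1: "trace_c ((kron P W * M + M * kron P W) * X) = 2 * trace_c (P * (Y * Y))
      + (trace_c (kron P (W * L) * X) + trace_c (kron P (L * W) * X))"
    by simp
  have "trace_c (kron P (W * L) * X) + trace_c (kron P (L * W) * X)
      = trace_c (kron P (W * L + L * W) * X)"
    using Pc Wc L(1) by (simp add: kron_add_right trX)
  also have "\<dots> = 2 * trace_c (kron P D * X)"
    unfolding L(3) using Pc D by (simp add: kron_add_right trX)
  finally have t1': "trace_c ((kron P W * M + M * kron P W) * X)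
      = 2 * trace_c (P * (Y * Y)) + 2 * trace_c (kron P D * X)"
    using t1 by simp
  have "trace_c (W * L + L * W) = 2 * trace_c (W * L)"
    using trace_c_comm[OF L(1) Wc] Wc L(1) by (simp add: trace_c_add[of _ d])
  then have WL: "trace_c (W * L) = 0"
    unfolding L(3) using D by (simp add: trace_c_add[of _ d])
  have WLL: "trace_c (W * (L * L)) = trace_c (D * L)"
    by (rule trace_c_SLD_square[OF Wc L(1) D(1) L(3)])
  have "kron P W * (M * M) = kron P W * M * M"
    using Pc Wc M by (simp add: assoc_mult_mat[of _ "r * d" "r * d" _ "r * d" _ "r * d"])
  also have "\<dots> = kron (P * Y) W * M + kron P (W * L) * M"
    using Pc Wc Y L M by (simp add: KM add_mult_distrib_mat[of _ "r * d" "r * d" _ _ "r * d"])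
  also have "\<dots> = kron (P * (Y * Y)) W + kron (P * Y) (W * L) + (kron (P * Y) (W * L) + kron P (W * (L * L)))"
    using Pc Wc Y L by (simp add: KM assoc_mult_mat[of _ r r _ r _ r] assoc_mult_mat[of _ d d _ d _ d])
  finally have "trace_c (kron P W * (M * M)) = trace_c (P * (Y * Y)) + trace_c P * trace_c (D * L)"
    using Pc Wc Y L W(2) by (simp add: trace_c_add[of _ "r * d"] trace_c_kron WL WLL)
  \<comment> \<open>With a real trace of \<open>P\<close>, the real part of the product of traces
    splits into a product of real parts.\<close>
  moreover have "Im (trace_c P) = 0"
  proof -
    have "Im (P $$ (i,i)) = 0" if "i < r" for i
      using arg_cong[OF hermitian_index[OF Pc psd_mat_hermitian[OF P] that that], of Im] by simp
    then show ?thesis using Pc by (simp add: trace_c_def)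
  qed
  ultimately have t2: "Re (trace_c (kron P W * (M * M)))
      = Re (trace_c (P * (Y * Y))) + Re (trace_c P) * Re (trace_c (D * L))"
    by simp
  have "Re (trace_c ((kron P W * M + M * kron P W) * X)) - Re (trace_c (kron P W * (M * M)))
      \<le> Re (trace_c (kron P W * (X * X)))"
    by (rule trace_c_square_completion[OF psd_mat_kron[OF P W(1)] X M Mh])
  then show ?thesis unfolding t1' t2 by simp
qed

end

subsection \<open>Diagonal blocks\<close>

text \<open>The sum \<open>S\<close> is given by its entries, the form in which the channel output
  and its derivative are computed.\<close>

lemma trace_c_sum_mult:
  assumes "S \<in> carrier_mat n n" "\<And>x. x \<in> K \<Longrightarrow> T x \<in> carrier_mat n n" "A \<in> carrier_mat n n"
    and "\<And>i j. i < n \<Longrightarrow> j < n \<Longrightarrow> S $$ (i,j) = (\<Sum>x\<in>K. T x $$ (i,j))"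
  shows "trace_c (S * A) = (\<Sum>x\<in>K. trace_c (T x * A))"
proof -
  have "trace_c (S * A) = (\<Sum>i<n. \<Sum>j<n. \<Sum>x\<in>K. T x $$ (i,j) * A $$ (j,i))"
    unfolding trace_c_mult[OF assms(1,3)] using assms(4)
    by (intro sum.cong refl) (simp add: sum_distrib_right)
  also have "\<dots> = (\<Sum>i<n. \<Sum>x\<in>K. \<Sum>j<n. T x $$ (i,j) * A $$ (j,i))"
    by (intro sum.cong refl sum.swap)
  also have "\<dots> = (\<Sum>x\<in>K. \<Sum>i<n. \<Sum>j<n. T x $$ (i,j) * A $$ (j,i))"
    by (rule sum.swap)
  also have "\<dots> = (\<Sum>x\<in>K. trace_c (T x * A))"
    using assms(2,3) by (intro sum.cong refl trace_c_mult[symmetric]) auto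
  finally show ?thesis .
qed

lemma psd_mat_sum:
  assumes S: "S \<in> carrier_mat n n" and T: "\<And>x. x \<in> K \<Longrightarrow> psd_mat n (T x)"
    and eq: "\<And>i j. i < n \<Longrightarrow> j < n \<Longrightarrow> S $$ (i,j) = (\<Sum>x\<in>K. T x $$ (i,j))"
  shows "psd_mat n S"
  unfolding psd_mat_def
proof (intro conjI ballI)
  show "mat_adjoint S = S"
  proof (rule hermitianI[OF S])
    fix i j assume ij: "i < n" "j < n"
    show "S $$ (i,j) = cnj (S $$ (j,i))"
      unfolding eq[OF ij] eq[OF ij(2,1)] cnj_sum
      using T ij by (intro sum.cong refl hermitian_index[of _ n]) (auto simp: psd_mat_def)
  qed
  fix v :: "complex Matrix.vec" assume v: "v \<in> carrier_vec n"
  have "(S *\<^sub>v v) \<bullet>c v = (\<Sum>i<n. \<Sum>j<n. \<Sum>x\<in>K. T x $$ (i,j) * v $ j * cnj (v $ i))"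
    unfolding quadratic_form_index[OF S v] by (intro sum.cong refl) (simp add: eq sum_distrib_right)
  also have "\<dots> = (\<Sum>i<n. \<Sum>x\<in>K. \<Sum>j<n. T x $$ (i,j) * v $ j * cnj (v $ i))"
    by (intro sum.cong refl sum.swap)
  also have "\<dots> = (\<Sum>x\<in>K. \<Sum>i<n. \<Sum>j<n. T x $$ (i,j) * v $ j * cnj (v $ i))"
    by (rule sum.swap)
  also have "\<dots> = (\<Sum>x\<in>K. (T x *\<^sub>v v) \<bullet>c v)"
    using T v by (intro sum.cong refl quadratic_form_index[symmetric]) (auto simp: psd_mat_def)
  finally show "0 \<le> Re ((S *\<^sub>v v) \<bullet>c v)"
    using T v by (auto simp: psd_mat_def intro!: sum_nonneg)
qed (rule S)

lemma trace_c_psd_nonneg: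
  assumes "psd_mat n W"
  shows "0 \<le> Re (trace_c W)"
proof -
  have "mat_adjoint (1\<^sub>m n) = (1\<^sub>m n :: complex mat)" by (rule hermitianI) auto
  then show ?thesis
    using trace_c_psd_square_nonneg[OF assms, of "1\<^sub>m n"] psd_mat_carrier[OF assms] by simp
qed

text \<open>The block (1 \<otimes> <x|) \<rho> (1 \<otimes> |x>): the unnormalized reference state
  belonging to the classical value \<open>x\<close>.\<close>

definition diag_block :: "nat \<Rightarrow> nat \<Rightarrow> complex mat \<Rightarrow> nat \<Rightarrow> complex mat" where
  "diag_block r d \<rho> x = Matrix.mat r r (\<lambda>(i,j). \<rho> $$ (i * d + x, j * d + x))"

text \<open>The operator \<Sum> Y x \<otimes> |x><x|, used as a test operator for the input
  state.\<close>

definition block_diag :: "nat \<Rightarrow> nat \<Rightarrow> (nat \<Rightarrow> complex mat) \<Rightarrow> complex mat" where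
  "block_diag r d Y = Matrix.mat (r * d) (r * d)
    (\<lambda>(p,q). if p mod d = q mod d then Y (p mod d) $$ (p div d, q div d) else 0)"

lemma diag_block_carrier [simp]: "diag_block r d \<rho> x \<in> carrier_mat r r"
  by (simp add: diag_block_def)

lemma diag_block_index [simp]:
  "i < r \<Longrightarrow> j < r \<Longrightarrow> diag_block r d \<rho> x $$ (i,j) = \<rho> $$ (i * d + x, j * d + x)"
  by (simp add: diag_block_def)

lemma block_diag_carrier [simp]: "block_diag r d Y \<in> carrier_mat (r * d) (r * d)"
  by (simp add: block_diag_def)

lemma block_diag_index:
  assumes "i < r" "j < r" "a < d" "b < d"
  shows "block_diag r d Y $$ (i * d + a, j * d + b) = (if a = b then Y a $$ (i,j) else 0)"
  using assms tensor_index_less[of i r a d] tensor_index_less[of j r b d]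
  by (simp add: block_diag_def)

lemma trace_c_diag_block: "\<rho> \<in> carrier_mat (r * d) (r * d) \<Longrightarrow> trace_c \<rho> = (\<Sum>x<d. trace_c (diag_block r d \<rho> x))"
  by (simp add: trace_c_def sum_tensor_index diag_block_def) (rule sum.swap)

text \<open>The quadratic form of the block at \<open>v\<close> is that of \<rho> at the vector v
  \<otimes> |x>, called \<open>w\<close> below.\<close>

lemma psd_mat_diag_block:
  assumes \<rho>: "psd_mat (r * d) \<rho>" and x: "x < d"
  shows "psd_mat r (diag_block r d \<rho> x)"
  unfolding psd_mat_def
proof (intro conjI ballI)
  show "mat_adjoint (diag_block r d \<rho> x) = diag_block r d \<rho> x"
  proof (rule hermitianI)
    fix i j assume ij: "i < r" "j < r"
    show "diag_block r d \<rho> x $$ (i,j) = cnj (diag_block r d \<rho> x $$ (j,i))"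
      using hermitian_index[OF psd_mat_carrier[OF \<rho>] psd_mat_hermitian[OF \<rho>]
          tensor_index_less[OF ij(1) x] tensor_index_less[OF ij(2) x]] ij
      by (simp add: diag_block_def)
  qed simp
  fix v :: "complex Matrix.vec" assume v: "v \<in> carrier_vec r"
  define w where "w = Matrix.vec (r * d) (\<lambda>p. if p mod d = x then v $ (p div d) else 0)"
  have w: "w \<in> carrier_vec (r * d)" by (simp add: w_def)
  have wi: "w $ (i * d + a) = (if a = x then v $ i else 0)" if "i < r" "a < d" for i a
    using that tensor_index_less[OF that] by (simp add: w_def)
  have "(\<rho> *\<^sub>v w) \<bullet>c w = (\<Sum>i<r. \<Sum>a<d. \<Sum>j<r. \<Sum>b<d.
      \<rho> $$ (i * d + a, j * d + b) * w $ (j * d + b) * cnj (w $ (i * d + a)))"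
    unfolding quadratic_form_index[OF psd_mat_carrier[OF \<rho>] w] sum_tensor_index ..
  also have "\<dots> = (\<Sum>i<r. \<Sum>a<d. \<Sum>j<r. \<Sum>b<d. if b = x then
      (if a = x then \<rho> $$ (i * d + x, j * d + x) * v $ j * cnj (v $ i) else 0) else 0)"
    by (intro sum.cong refl) (simp add: wi)
  also have "\<dots> = (\<Sum>i<r. \<Sum>a<d. if a = x then
      \<Sum>j<r. \<rho> $$ (i * d + x, j * d + x) * v $ j * cnj (v $ i) else 0)"
    using x by (intro sum.cong refl) simp
  also have "\<dots> = (\<Sum>i<r. \<Sum>j<r. \<rho> $$ (i * d + x, j * d + x) * v $ j * cnj (v $ i))"
    using x by simp
  also have "\<dots> = (diag_block r d \<rho> x *\<^sub>v v) \<bullet>c v"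
    unfolding quadratic_form_index[OF diag_block_carrier v] by (simp add: diag_block_def)
  finally show "0 \<le> Re ((diag_block r d \<rho> x *\<^sub>v v) \<bullet>c v)"
    using \<rho> w by (auto simp: psd_mat_def)
qed simp

lemma block_diag_mult:
  assumes "\<And>x. x < d \<Longrightarrow> Y x \<in> carrier_mat r r" "\<And>x. x < d \<Longrightarrow> Z x \<in> carrier_mat r r"
  shows "block_diag r d Y * block_diag r d Z = block_diag r d (\<lambda>x. Y x * Z x)"
proof (rule tensor_mat_eqI[of _ r d])
  fix i j a b assume h: "i < r" "j < r" "a < d" "b < d"
  have "(block_diag r d Y * block_diag r d Z) $$ (i * d + a, j * d + b)
      = (\<Sum>p<r * d. block_diag r d Y $$ (i * d + a, p) * block_diag r d Z $$ (p, j * d + b))"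
    by (rule mult_mat_index[OF block_diag_carrier block_diag_carrier
          tensor_index_less[OF h(1,3)] tensor_index_less[OF h(2,4)]])
  also have "\<dots> = (\<Sum>k<r. \<Sum>c<d. if c = a then (if a = b then Y a $$ (i,k) * Z a $$ (k,j) else 0) else 0)"
    unfolding sum_tensor_index using h by (intro sum.cong refl) (simp add: block_diag_index)
  also have "\<dots> = (if a = b then (Y a * Z a) $$ (i,j) else 0)"
    unfolding mult_mat_index[OF assms(1)[OF h(3)] assms(2)[OF h(3)] h(1,2)] using h by simp
  also have "\<dots> = block_diag r d (\<lambda>x. Y x * Z x) $$ (i * d + a, j * d + b)"
    using h by (simp add: block_diag_index del: index_mult_mat(1))
  finally show "(block_diag r d Y * block_diag r d Z) $$ (i * d + a, j * d + b)
      = block_diag r d (\<lambda>x. Y x * Z x) $$ (i * d + a, j * d + b)" .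
qed auto

lemma mat_adjoint_block_diag:
  assumes "\<And>x. x < d \<Longrightarrow> Y x \<in> carrier_mat r r" "\<And>x. x < d \<Longrightarrow> mat_adjoint (Y x) = Y x"
  shows "mat_adjoint (block_diag r d Y) = block_diag r d Y"
proof (rule tensor_mat_eqI[of _ r d])
  fix i j a b assume h: "i < r" "j < r" "a < d" "b < d"
  have "mat_adjoint (block_diag r d Y) $$ (i * d + a, j * d + b)
      = cnj (block_diag r d Y $$ (j * d + b, i * d + a))"
    by (rule mat_adjoint_index) (use h tensor_index_less in \<open>simp_all add: block_diag_def\<close>)
  then show "mat_adjoint (block_diag r d Y) $$ (i * d + a, j * d + b)
      = block_diag r d Y $$ (i * d + a, j * d + b)"
    using h hermitian_index[OF assms(1,2), of a i j] by (cases "a = b") (simp_all add: block_diag_index)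
qed auto

text \<open>A block-diagonal operator pairs only with the diagonal blocks of \<rho>, which are all
  that the channel sees of its input.\<close>

lemma trace_c_mult_block_diag:
  assumes "\<rho> \<in> carrier_mat (r * d) (r * d)" "\<And>x. x < d \<Longrightarrow> Y x \<in> carrier_mat r r"
  shows "trace_c (\<rho> * block_diag r d Y) = (\<Sum>x<d. trace_c (diag_block r d \<rho> x * Y x))"
proof -
  have "trace_c (\<rho> * block_diag r d Y) = (\<Sum>i<r. \<Sum>a<d. \<Sum>j<r. \<Sum>b<d.
      if b = a then \<rho> $$ (i * d + a, j * d + a) * Y a $$ (j,i) else 0)"
    unfolding trace_c_mult[OF assms(1) block_diag_carrier] sum_tensor_index
    by (intro sum.cong refl) (simp add: block_diag_index)
  also have "\<dots> = (\<Sum>i<r. \<Sum>a<d. \<Sum>j<r. \<rho> $$ (i * d + a, j * d + a) * Y a $$ (j,i))"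
    by (intro sum.cong refl) simp
  also have "\<dots> = (\<Sum>a<d. \<Sum>i<r. \<Sum>j<r. \<rho> $$ (i * d + a, j * d + a) * Y a $$ (j,i))"
    by (rule sum.swap)
  also have "\<dots> = (\<Sum>x<d. trace_c (diag_block r d \<rho> x * Y x))"
  proof (rule sum.cong[OF refl])
    fix x assume "x \<in> {..<d}"
    then show "(\<Sum>i<r. \<Sum>j<r. \<rho> $$ (i * d + x, j * d + x) * Y x $$ (j,i))
        = trace_c (diag_block r d \<rho> x * Y x)"
      using assms(2)[of x] by (subst trace_c_mult[of _ r r]) (auto simp: diag_block_def)
  qed
  finally show ?thesis .
qed

subsection \<open>Classical--quantum channels\<close>

text \<open>With derivative 0 the infinite case would need \<open>0 < 0\<close>, and the finite
  value is the trace of a zero matrix.\<close>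

lemma SLD_fisher_const:
  assumes "psd_mat n \<rho>"
  shows "SLD_fisher n (\<lambda>_. \<rho>) t = 0"
proof -
  have D: "mat_deriv n (\<lambda>_. \<rho>) t = 0\<^sub>m n n"
    by (rule eq_matI) (auto simp: mat_deriv_def)
  have Dh: "mat_adjoint (mat_deriv n (\<lambda>_. \<rho>) t) = mat_deriv n (\<lambda>_. \<rho>) t"
    unfolding D by (rule hermitianI) auto
  have z: "trace_c (0\<^sub>m n n) = 0" by (simp add: trace_c_def)
  show ?thesis
    by (rule SLD_fisher_cases[where F = "\<lambda>_. \<rho>" and t = t, OF assms Dh])
      (simp_all add: D z zero_ereal_def)
qed

text \<open>Differentiate the constant trace 1.\<close>

lemma trace_c_mat_deriv_density:
  assumes "\<And>s. density_op n (F s)" "mat_family_diff n F"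
  shows "trace_c (mat_deriv n F t) = 0"
proof -
  have "((\<lambda>s. \<Sum>i<n. F s $$ (i,i)) has_vector_derivative (\<Sum>i<n. mat_deriv n F t $$ (i,i))) (at t)"
    by (rule has_vector_derivative_sum) (use assms(2) in \<open>auto intro: mat_family_diff_has_derivative\<close>)
  moreover have "(\<lambda>s. \<Sum>i<n. F s $$ (i,i)) = (\<lambda>_. 1)"
  proof
    fix s show "(\<Sum>i<n. F s $$ (i,i)) = 1"
      using assms(1)[of s] by (auto simp: density_op_def trace_c_def)
  qed
  ultimately have "((\<lambda>_. 1::complex) has_vector_derivative (\<Sum>i<n. mat_deriv n F t $$ (i,i))) (at t)"
    by simp
  then have "(\<Sum>i<n. mat_deriv n F t $$ (i,i)) = 0"
    by (metis has_vector_derivative_const vector_derivative_unique_at)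
  then show ?thesis by (simp add: trace_c_def mat_deriv_def)
qed

section \<open>Outputs of the channel on bipartite inputs\<close>

lemma id_tensor_cq_index:
  assumes "i < r" "j < r" "a < dB" "b < dB"
  shows "id_tensor r dX dB (cq_channel dX dB \<omega> s) \<rho> $$ (i * dB + a, j * dB + b)
    = (\<Sum>x<dX. \<rho> $$ (i * dX + x, j * dX + x) * \<omega> x s $$ (a,b))"
  using assms tensor_index_less[of i r a dB] tensor_index_less[of j r b dB]
  by (simp add: id_tensor_def cq_channel_def)

lemma id_tensor_carrier: "id_tensor r dX dB N \<rho> \<in> carrier_mat (r * dB) (r * dB)"
  by (simp add: id_tensor_def)

context
  fixes dX dB :: nat and \<omega> :: "nat \<Rightarrow> real \<Rightarrow> complex mat"
  assumes density: "\<And>x s. x < dX \<Longrightarrow> density_op dB (\<omega> x s)"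
    and diff: "\<And>x. x < dX \<Longrightarrow> mat_family_diff dB (\<omega> x)"
begin

lemma omega_carrier: "x < dX \<Longrightarrow> \<omega> x s \<in> carrier_mat dB dB"
  using density by (simp add: density_op_def)

lemma id_tensor_cq_kron:
  assumes "p < r * dB" "q < r * dB"
  shows "id_tensor r dX dB (cq_channel dX dB \<omega> s) \<rho> $$ (p,q)
    = (\<Sum>x<dX. kron (diag_block r dX \<rho> x) (\<omega> x s) $$ (p,q))"
proof -
  obtain i a where p: "i < r" "a < dB" "p = i * dB + a" using assms(1) by (rule tensor_index_cases)
  obtain j b where q: "j < r" "b < dB" "q = j * dB + b" using assms(2) by (rule tensor_index_cases)
  show ?thesis
    unfolding p(3) q(3) id_tensor_cq_index[OF p(1) q(1) p(2) q(2)]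
    using p(1,2) q(1,2) omega_carrier
    by (intro sum.cong refl) (simp add: kron_index[OF diag_block_carrier])
qed

lemma psd_mat_id_tensor_cq:
  assumes "psd_mat (r * dX) \<rho>"
  shows "psd_mat (r * dB) (id_tensor r dX dB (cq_channel dX dB \<omega> s) \<rho>)"
proof (rule psd_mat_sum[OF id_tensor_carrier])
  fix x assume "x \<in> {..<dX}"
  then show "psd_mat (r * dB) (kron (diag_block r dX \<rho> x) (\<omega> x s))"
    using density by (intro psd_mat_kron psd_mat_diag_block[OF assms]) (auto simp: density_op_iff)
qed (rule id_tensor_cq_kron)

text \<open>Product rule: one summand carries the change of the input family, the other the change
  of the channel. They are bounded separately, by the input information and by that of the \<omega>
  x.\<close>

lemma id_tensor_cq_has_derivative:
  assumes F: "mat_family_diff (r * dX) F" and p: "p < r * dB" and q: "q < r * dB"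
  shows "((\<lambda>s. id_tensor r dX dB (cq_channel dX dB \<omega> s) (F s) $$ (p,q)) has_vector_derivative
    (\<Sum>x<dX. (kron (diag_block r dX (mat_deriv (r * dX) F t) x) (\<omega> x t)
        + kron (diag_block r dX (F t) x) (mat_deriv dB (\<omega> x) t)) $$ (p,q))) (at t)"
proof -
  obtain i a where p': "i < r" "a < dB" "p = i * dB + a" using p by (rule tensor_index_cases)
  obtain j b where q': "j < r" "b < dB" "q = j * dB + b" using q by (rule tensor_index_cases)
  have "((\<lambda>s. \<Sum>x<dX. F s $$ (i * dX + x, j * dX + x) * \<omega> x s $$ (a,b)) has_vector_derivative
    (\<Sum>x<dX. F t $$ (i * dX + x, j * dX + x) * mat_deriv dB (\<omega> x) t $$ (a,b)
        + mat_deriv (r * dX) F t $$ (i * dX + x, j * dX + x) * \<omega> x t $$ (a,b))) (at t)"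
    using p' q' diff
    by (intro has_vector_derivative_sum has_vector_derivative_mult mat_family_diff_has_derivative F)
      (auto intro: tensor_index_less)
  also have "(\<lambda>s. \<Sum>x<dX. F s $$ (i * dX + x, j * dX + x) * \<omega> x s $$ (a,b))
      = (\<lambda>s. id_tensor r dX dB (cq_channel dX dB \<omega> s) (F s) $$ (p,q))"
    unfolding p'(3) q'(3) id_tensor_cq_index[OF p'(1) q'(1) p'(2) q'(2)] ..
  also have "(\<Sum>x<dX. F t $$ (i * dX + x, j * dX + x) * mat_deriv dB (\<omega> x) t $$ (a,b)
        + mat_deriv (r * dX) F t $$ (i * dX + x, j * dX + x) * \<omega> x t $$ (a,b))
      = (\<Sum>x<dX. (kron (diag_block r dX (mat_deriv (r * dX) F t) x) (\<omega> x t)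
        + kron (diag_block r dX (F t) x) (mat_deriv dB (\<omega> x) t)) $$ (p,q))"
  proof (rule sum.cong[OF refl])
    fix x assume "x \<in> {..<dX}"
    then have \<omega>: "\<omega> x t \<in> carrier_mat dB dB" using omega_carrier by simp
    note c = kron_carrier[OF diag_block_carrier[of r dX "F t" x] mat_deriv_carrier[of dB "\<omega> x" t]]
    show "F t $$ (i * dX + x, j * dX + x) * mat_deriv dB (\<omega> x) t $$ (a,b)
        + mat_deriv (r * dX) F t $$ (i * dX + x, j * dX + x) * \<omega> x t $$ (a,b)
      = (kron (diag_block r dX (mat_deriv (r * dX) F t) x) (\<omega> x t)
        + kron (diag_block r dX (F t) x) (mat_deriv dB (\<omega> x) t)) $$ (p,q)"
      unfolding p'(3) q'(3)
      using p'(1,2) q'(1,2) tensor_index_less[OF p'(1,2)] tensor_index_less[OF q'(1,2)]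
        kron_index[OF diag_block_carrier \<omega>, of i r j a b] carrier_matD[OF c]
        kron_index[OF diag_block_carrier mat_deriv_carrier, of i r j a dB b]
      by simp
  qed
  finally show ?thesis .
qed

text \<open>Stated with a real bound \<open>J + C\<close>, so that \<open>SLD_fisher_leI\<close>
  reduces it to one test operator at a time; subtracting \<open>J\<close> then gives the amortized
  bound.\<close>

lemma SLD_fisher_cq_output_le:
  assumes r: "\<And>s. density_op (r * dX) (F s)" and F: "mat_family_diff (r * dX) F"
    and fin: "SLD_fisher (r * dX) F t = ereal J"
    and \<omega>_le: "\<And>x. x < dX \<Longrightarrow> SLD_fisher dB (\<omega> x) t \<le> ereal C"
  shows "SLD_fisher (r * dB) (\<lambda>s. id_tensor r dX dB (cq_channel dX dB \<omega> s) (F s)) t \<le> ereal (J + C)"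
proof -
  define \<sigma> where "\<sigma> s = id_tensor r dX dB (cq_channel dX dB \<omega> s) (F s)" for s
  have Fpsd: "psd_mat (r * dX) (F s)" for s using r by (simp add: density_op_iff)
  have \<omega>psd: "psd_mat dB (\<omega> x s)" if "x < dX" for x s using density[OF that] by (simp add: density_op_iff)
  have \<sigma>psd: "psd_mat (r * dB) (\<sigma> s)" for s
    unfolding \<sigma>_def by (rule psd_mat_id_tensor_cq[OF Fpsd])
  have \<sigma>diff: "mat_family_diff (r * dB) \<sigma>"
    unfolding mat_family_diff_def \<sigma>_def
    by (intro allI impI differentiableI_vector[OF id_tensor_cq_has_derivative[OF F]])
  define D where "D = mat_deriv (r * dB) \<sigma> t"
  define P where "P x = diag_block r dX (F t) x" for x
  define P' where "P' x = diag_block r dX (mat_deriv (r * dX) F t) x" for x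
  define V where "V x = mat_deriv dB (\<omega> x) t" for x
  have P: "psd_mat r (P x)" if "x < dX" for x
    unfolding P_def by (rule psd_mat_diag_block[OF Fpsd that])
  have c: "P x \<in> carrier_mat r r" "P' x \<in> carrier_mat r r" "V x \<in> carrier_mat dB dB" for x
    by (simp_all add: P_def P'_def V_def)
  have Dh: "mat_adjoint D = D"
    unfolding D_def using \<sigma>psd by (intro mat_deriv_hermitian[OF \<sigma>diff]) (auto simp: psd_mat_def)
  have D_index: "D $$ (p,q) = (\<Sum>x<dX. (kron (P' x) (\<omega> x t) + kron (P x) (V x)) $$ (p,q))"
    if "p < r * dB" "q < r * dB" for p q
    unfolding D_def P_def P'_def V_def \<sigma>_def
    by (rule mat_deriv_index[OF that id_tensor_cq_has_derivative[OF F that]])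
  \<comment> \<open>The real bound \<open>C\<close> excludes the infinite case, so each \<omega> x
    has a logarithmic derivative.\<close>
  have "\<exists>L. L \<in> carrier_mat dB dB \<and> mat_adjoint L = L \<and> \<omega> x t * L + L * \<omega> x t = V x + V x
      \<and> Re (trace_c (V x * L)) \<le> C" if x: "x < dX" for x
  proof -
    have Vh: "mat_adjoint (mat_deriv dB (\<omega> x) t) = mat_deriv dB (\<omega> x) t"
      using \<omega>psd[OF x] by (intro mat_deriv_hermitian[OF diff[OF x]]) (auto simp: psd_mat_def)
    show ?thesis
      by (rule SLD_fisher_cases[where F = "\<omega> x" and t = t, OF \<omega>psd[OF x] Vh])
        (use \<omega>_le[OF x] in \<open>auto simp: V_def\<close>)
  qed
  then obtain L where L: "\<And>x. x < dX \<Longrightarrow> L x \<in> carrier_mat dB dB" "\<And>x. x < dX \<Longrightarrow> mat_adjoint (L x) = L x"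
    "\<And>x. x < dX \<Longrightarrow> \<omega> x t * L x + L x * \<omega> x t = V x + V x"
    "\<And>x. x < dX \<Longrightarrow> Re (trace_c (V x * L x)) \<le> C"
    by metis
  have Fh: "mat_adjoint (mat_deriv (r * dX) F t) = mat_deriv (r * dX) F t"
    using Fpsd by (intro mat_deriv_hermitian[OF F]) (auto simp: psd_mat_def)
  obtain L0 where L0: "L0 \<in> carrier_mat (r * dX) (r * dX)" "mat_adjoint L0 = L0"
      "F t * L0 + L0 * F t = mat_deriv (r * dX) F t + mat_deriv (r * dX) F t"
      "J = Re (trace_c (mat_deriv (r * dX) F t * L0))"
    by (rule SLD_fisher_cases[where F = F and t = t, OF Fpsd Fh]) (use fin in auto)
  show ?thesis
    unfolding \<sigma>_def[symmetric]
  proof (rule SLD_fisher_leI[where F = \<sigma> and t = t, OF \<sigma>psd])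
    show "mat_adjoint (mat_deriv (r * dB) \<sigma> t) = mat_deriv (r * dB) \<sigma> t"
      using Dh by (simp add: D_def)
    fix X :: "complex mat" assume X: "X \<in> carrier_mat (r * dB) (r * dB)" "mat_adjoint X = X"
    \<comment> \<open>By \<open>trace_c_kron_mult\<close>, pairing A \<otimes> \<omega> x with
      \<open>X\<close> is the same as pairing A with \<open>Y x\<close>.\<close>
    define Y where "Y x = weighted_ptrace r dB (\<omega> x t) X" for x
    have Yc: "Y x \<in> carrier_mat r r" for x by (simp add: Y_def)
    have Yh: "mat_adjoint (Y x) = Y x" if "x < dX" for x
      unfolding Y_def using \<omega>psd[OF that] X
      by (intro weighted_ptrace_hermitian) (auto simp: psd_mat_def)
    define B where "B = block_diag r dX Y"
    have tD: "trace_c (D * X) = (\<Sum>x<dX. trace_c (P' x * Y x) + trace_c (kron (P x) (V x) * X))"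
    proof -
      have "trace_c (D * X) = (\<Sum>x<dX. trace_c ((kron (P' x) (\<omega> x t) + kron (P x) (V x)) * X))"
        by (rule trace_c_sum_mult[of _ "r * dB"])
          (use c omega_carrier X D_index in \<open>auto simp: D_def\<close>)
      also have "\<dots> = (\<Sum>x<dX. trace_c (P' x * Y x) + trace_c (kron (P x) (V x) * X))"
        unfolding Y_def using c omega_carrier X
        by (intro sum.cong refl)
          (simp add: add_mult_distrib_mat[of _ "r * dB" "r * dB" _ _ "r * dB"]
            trace_c_add[of _ "r * dB"] trace_c_kron_mult)
      finally show ?thesis .
    qed
    have t\<sigma>: "trace_c (\<sigma> t * (X * X)) = (\<Sum>x<dX. trace_c (kron (P x) (\<omega> x t) * (X * X)))"
      by (rule trace_c_sum_mult[of _ "r * dB"])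
        (use c omega_carrier X id_tensor_cq_kron in \<open>auto simp: \<sigma>_def P_def intro: id_tensor_carrier\<close>)
    \<comment> \<open>Kronecker square completion for a single \<open>x\<close>. The trace of
      \<open>P x\<close> is nonnegative, so the information of \<omega> x may be replaced by its
      bound \<open>C\<close>.\<close>
    have x_le: "2 * Re (trace_c (P' x * Y x) + trace_c (kron (P x) (V x) * X))
        - Re (trace_c (kron (P x) (\<omega> x t) * (X * X)))
      \<le> 2 * Re (trace_c (P' x * Y x)) - Re (trace_c (P x * (Y x * Y x))) + Re (trace_c (P x)) * C"
      if x: "x < dX" for x
    proof -
      have V0: "trace_c (V x) = 0"
        unfolding V_def by (rule trace_c_mat_deriv_density[OF density[OF x] diff[OF x]])
      have \<omega>1: "trace_c (\<omega> x t) = 1" using density[OF x] by (simp add: density_op_iff)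
      have "Re (trace_c (P x)) * Re (trace_c (V x * L x)) \<le> Re (trace_c (P x)) * C"
        by (rule mult_left_mono[OF L(4)[OF x] trace_c_psd_nonneg[OF P[OF x]]])
      then show ?thesis
        using trace_c_kron_square_completion[OF P[OF x] \<omega>psd[OF x] \<omega>1 L(1-3)[OF x] c(3) V0 X]
        by (simp add: Y_def)
    qed
    have "2 * Re (trace_c (D * X)) - Re (trace_c (\<sigma> t * (X * X)))
      = (\<Sum>x<dX. 2 * Re (trace_c (P' x * Y x) + trace_c (kron (P x) (V x) * X))
        - Re (trace_c (kron (P x) (\<omega> x t) * (X * X))))"
      unfolding tD t\<sigma> by (simp only: Re_sum sum_subtractf sum_distrib_left)
    also have "\<dots> \<le> (\<Sum>x<dX. 2 * Re (trace_c (P' x * Y x)) - Re (trace_c (P x * (Y x * Y x)))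
        + Re (trace_c (P x)) * C)"
      using x_le by (intro sum_mono) simp
    also have "\<dots> = 2 * Re (\<Sum>x<dX. trace_c (P' x * Y x)) - Re (\<Sum>x<dX. trace_c (P x * (Y x * Y x)))
        + Re (\<Sum>x<dX. trace_c (P x)) * C"
      by (simp add: sum.distrib sum_subtractf sum_distrib_left sum_distrib_right)
    also have "(\<Sum>x<dX. trace_c (P' x * Y x)) = trace_c (mat_deriv (r * dX) F t * B)"
      unfolding B_def P'_def by (rule trace_c_mult_block_diag[symmetric]) (simp_all add: Yc)
    also have "(\<Sum>x<dX. trace_c (P x * (Y x * Y x))) = trace_c (F t * (B * B))"
      unfolding B_def P_def block_diag_mult[of dX Y r Y, OF Yc Yc]
      by (rule trace_c_mult_block_diag[symmetric]) (simp_all add: Yc psd_mat_carrier[OF Fpsd])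
    \<comment> \<open>The weights are the probabilities of the classical values, so the multiples of
      \<open>C\<close> add up to exactly \<open>C\<close>.\<close>
    also have "(\<Sum>x<dX. trace_c (P x)) = 1"
      unfolding P_def using r[of t] by (simp add: density_op_iff psd_mat_carrier flip: trace_c_diag_block)
    also have "2 * Re (trace_c (mat_deriv (r * dX) F t * B)) - Re (trace_c (F t * (B * B))) + Re 1 * C
      \<le> J + C"
      using SLD_fisher_ge[where F = F and t = t, OF Fpsd L0(1-3), of B]
        mat_adjoint_block_diag[of dX Y r, OF Yc Yh] L0(4)
      by (simp add: B_def)
    finally show "2 * Re (trace_c (mat_deriv (r * dB) \<sigma> t * X)) - Re (trace_c (\<sigma> t * (X * X))) \<le> J + C"
      by (simp add: D_def)
  qed
qed

end

section \<open>Comparison of the three suprema\<close>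

theorem mainTheorem7:
  fixes dX dB :: nat and \<omega> :: "nat \<Rightarrow> real \<Rightarrow> complex mat" and t :: real
  assumes "0 < dX"
    and "\<And>x s. x < dX \<Longrightarrow> density_op dB (\<omega> x s)"
    and "\<And>x. x < dX \<Longrightarrow> mat_family_diff dB (\<omega> x)"
  shows "channel_fisher dX dB (cq_channel dX dB \<omega>) t
           = amortized_channel_fisher dX dB (cq_channel dX dB \<omega>) t
       \<and> amortized_channel_fisher dX dB (cq_channel dX dB \<omega>) t
           = (SUP x \<in> {..<dX}. SLD_fisher dB (\<omega> x) t)"
proof -
  let ?N = "cq_channel dX dB \<omega>"
  let ?S = "SUP x \<in> {..<dX}. SLD_fisher dB (\<omega> x) t"
  have 1: "?S \<le> channel_fisher dX dB ?N t"
  proof (rule SUP_least)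
    fix x assume "x \<in> {..<dX}"
    then have x: "x < dX" by simp
    \<comment> \<open>The basis state |x><x| with a one-dimensional reference; the channel maps it
      to \<omega> x.\<close>
    define \<rho> where "\<rho> = mat_diag dX (\<lambda>j. if j = x then (1::complex) else 0)"
    have \<rho>c: "\<rho> \<in> carrier_mat dX dX" by (simp add: \<rho>_def)
    have \<rho>h: "mat_adjoint \<rho> = \<rho>" by (rule hermitianI[OF \<rho>c]) (auto simp: \<rho>_def mat_diag_def)
    have "\<rho> * mat_adjoint \<rho> = \<rho>"
      unfolding \<rho>h unfolding \<rho>_def mat_diag_diag by (simp add: if_distrib cong: if_cong)
    then have "psd_mat dX \<rho>" using psd_mat_mult_adjoint[OF \<rho>c] by simp
    moreover have "trace_c \<rho> = 1" using x by (simp add: trace_c_def \<rho>_def mat_diag_def)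
    ultimately have \<rho>: "density_op (1 * dX) \<rho>" by (simp add: density_op_iff)
    have out: "id_tensor 1 dX dB (?N s) \<rho> = \<omega> x s" for s
    proof (rule eq_matI)
      fix a b assume "a < dim_row (\<omega> x s)" "b < dim_col (\<omega> x s)"
      then have ab: "a < dB" "b < dB" using assms(2)[OF x, of s] by (auto simp: density_op_def)
      have "id_tensor 1 dX dB (?N s) \<rho> $$ (a,b) = (\<Sum>y<dX. \<rho> $$ (y,y) * \<omega> y s $$ (a,b))"
        using id_tensor_cq_index[where r = 1 and i = 0 and j = 0 and \<omega> = \<omega>, OF _ _ ab]
        by simp
      also have "\<dots> = (\<Sum>y<dX. if y = x then \<omega> y s $$ (a,b) else 0)"
        by (intro sum.cong refl) (simp add: \<rho>_def mat_diag_def)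
      finally show "id_tensor 1 dX dB (?N s) \<rho> $$ (a,b) = \<omega> x s $$ (a,b)" using x by simp
    qed (use assms(2)[OF x, of s] in \<open>auto simp: id_tensor_def density_op_def\<close>)
    have "SLD_fisher dB (\<omega> x) t
        = SLD_fisher (fst (1::nat, \<rho>) * dB) (\<lambda>s. id_tensor (fst (1, \<rho>)) dX dB (?N s) (snd (1::nat, \<rho>))) t"
      by (simp add: out[unfolded One_nat_def])
    also have "\<dots> \<le> channel_fisher dX dB ?N t"
      unfolding channel_fisher_def by (rule SUP_upper) (use \<rho> in auto)
    finally show "SLD_fisher dB (\<omega> x) t \<le> channel_fisher dX dB ?N t" .
  qed
  \<comment> \<open>A fixed input is a constant family with information 0, so nothing is
    subtracted.\<close>
  have 2: "channel_fisher dX dB ?N t \<le> amortized_channel_fisher dX dB ?N t"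
    unfolding channel_fisher_def
  proof (rule SUP_least, clarify)
    fix r :: nat and \<rho> assume r: "0 < r" and \<rho>: "density_op (r * dX) \<rho>"
    have 0: "SLD_fisher (r * dX) (\<lambda>_. \<rho>) t = 0"
      using \<rho> by (intro SLD_fisher_const) (simp add: density_op_iff)
    have "SLD_fisher (r * dB) (\<lambda>s. id_tensor r dX dB (?N s) \<rho>) t
        = SLD_fisher (fst (r, \<lambda>_::real. \<rho>) * dB)
            (\<lambda>s. id_tensor (fst (r, \<lambda>_::real. \<rho>)) dX dB (?N s) (snd (r, \<lambda>_. \<rho>) s)) t
          - SLD_fisher (fst (r, \<lambda>_::real. \<rho>) * dX) (snd (r, \<lambda>_. \<rho>)) t"
      by (simp add: 0)
    also have "\<dots> \<le> amortized_channel_fisher dX dB ?N t"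
      unfolding amortized_channel_fisher_def
      by (rule SUP_upper) (use r \<rho> in \<open>auto simp: 0 mat_family_diff_def\<close>)
    finally show "SLD_fisher (fst (r, \<rho>) * dB) (\<lambda>s. id_tensor (fst (r, \<rho>)) dX dB (?N s) (snd (r, \<rho>))) t
        \<le> amortized_channel_fisher dX dB ?N t"
      by simp
  qed
  \<comment> \<open>Together with the finiteness condition on input families this makes the
    subtracted information a real number.\<close>
  have not_minf: "SLD_fisher n F t \<noteq> - \<infinity>" for n F
    by (simp add: SLD_fisher_def Let_def)
  have 3: "amortized_channel_fisher dX dB ?N t \<le> ?S"
    unfolding amortized_channel_fisher_def
  proof (rule SUP_least, clarify)
    fix r :: nat and F
    assume F: "\<forall>s. density_op (r * dX) (F s)" "mat_family_diff (r * dX) F" "SLD_fisher (r * dX) F t < \<infinity>"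
    obtain J where J: "SLD_fisher (r * dX) F t = ereal J"
      using F(3) not_minf[of "r * dX" F] by (cases "SLD_fisher (r * dX) F t") auto
    have "SLD_fisher (r * dB) (\<lambda>s. id_tensor r dX dB (?N s) (F s)) t - ereal J \<le> ?S"
    \<comment> \<open>Only a real supremum needs the output bound; an infinite one leaves nothing to
      prove.\<close>
    proof (cases ?S)
      case (real C)
      have "SLD_fisher dB (\<omega> x) t \<le> ereal C" if "x < dX" for x
        unfolding real[symmetric] by (rule SUP_upper) (use that in simp)
      from SLD_fisher_cq_output_le[where \<omega> = \<omega>, OF assms(2,3) _ F(2) J this] F(1)
      have "SLD_fisher (r * dB) (\<lambda>s. id_tensor r dX dB (?N s) (F s)) t \<le> ereal (J + C)" by blast
      then show ?thesis
        unfolding real by (simp add: ereal_minus_le_iff add.commute)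
    next
      \<comment> \<open>The value of an empty supremum, impossible here because
        \<open>0 < dX\<close> provides the member at 0.\<close>
      case MInf
      have "SLD_fisher dB (\<omega> 0) t \<le> ?S" by (rule SUP_upper) (use assms(1) in simp)
      then show ?thesis using MInf not_minf[of dB "\<omega> 0"] by simp
    qed simp
    then show "SLD_fisher (fst (r, F) * dB) (\<lambda>s. id_tensor (fst (r, F)) dX dB (?N s) (snd (r, F) s)) t
        - SLD_fisher (fst (r, F) * dX) (snd (r, F)) t \<le> ?S"
      by (simp add: J)
  qed
  show ?thesis using 1 2 3 by (metis order_antisym order_trans)
qed

end
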